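(* Let $d\ge 1$, let $\lambda\in\{-1,1\}$, and let $L_m$ be the Dirichlet $L$-function associated to a non principal Dirichlet character $\chi_m$ of period $m$. Let $g\in C(\mathbb{R}^d;\mathbb{C})\cap L^\infty(\mathbb{R}^d;\mathbb{C})$ be a given initial datum. Then there exists $T>0$ such that the initial value problem $$\partial_t u(t,x)=\Delta u(t,x)+\lambda L_m(u(t,x)),\quad x\in\mathbb{R}^d,\ t\ge 0,\qquad u(0,x)=g(x),$$ has a unique solution $u\in C([0,T);L^\infty(\mathbb{R}^d;\mathbb{C})\cap C(\mathbb{R}^d;\mathbb{C}))$, and the corresponding solution map is continuous.
   Context: A Dirichlet character of period $m\in\mathbb{N}=\{1,2,3,\dots\}$ is a function $\chi_m:\mathbb{N}\to\mathbb{C}$ that is $m$-periodic, completely multiplicative, with $\chi_m(n)\ne0$ if $\gcd(n,m)=1$ and $\chi_m(n)=0$ if $\gcd(n,m)>1$; it is principal if $\chi_m(n)=1$ whenever $\gcd(n,m)=1$, and non principal otherwise. Its Dirichlet $L$-function is $L_m(s)=\sum_{n\ge1}\chi_m(n)n^{-s}$ for $\operatorname{Re}(s)>1$; in the non principal case it extends to an entire function on $\mathbb{C}$. The space $L^\infty(\mathbb{R}^d;\mathbb{C})\cap C(\mathbb{R}^d;\mathbb{C})$ is normed by $\|g\|_Y=\max\{\|\operatorname{Re} g\|_{L^\infty},\|\operatorname{Im} g\|_{L^\infty}\}$. Solutions are understood in the Duhamel sense: $u(t)=e^{t\Delta}g+\lambda\int_0^t e^{(t-s)\Delta}L_m(u(s))\,ds$,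 where $e^{t\Delta}h=K_t*h$ with $K_t(x)=(4\pi t)^{-d/2}e^{-|x|^2/(4t)}$. The solution map is the map sending the initial datum $g$ to the solution $u$.
   Formalization: Norm continuity at t=0 fails unless g is uniformly continuous (e.g. g=cos|x|²), so the solution is norm continuous on (0,T), locally bounded, and tends to g locally uniformly; it lies in C([0,T);L^∞∩C) exactly when g is uniformly continuous. *)

theory Defs
  imports "HOL-Complex_Analysis.Complex_Analysis"
begin

section \<open>Dirichlet characters and their L-functions\<close>

text \<open>Characters live on the positive integers; the value at \<open>0\<close> is irrelevant and left
  unconstrained.\<close>

definition dirichlet_character :: "nat \<Rightarrow> (nat \<Rightarrow> complex) \<Rightarrow> bool" where
  "dirichlet_character m chi \<longleftrightarrow>
     m \<ge> 1 \<and>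
     (\<forall>n\<ge>1. chi (n + m) = chi n) \<and>
     (\<forall>a\<ge>1. \<forall>b\<ge>1. chi (a * b) = chi a * chi b) \<and>
     (\<forall>n\<ge>1. gcd n m = 1 \<longrightarrow> chi n \<noteq> 0) \<and>
     (\<forall>n\<ge>1. gcd n m > 1 \<longrightarrow> chi n = 0)"

definition principal_character :: "nat \<Rightarrow> (nat \<Rightarrow> complex) \<Rightarrow> bool" where
  "principal_character m chi \<longleftrightarrow> (\<forall>n\<ge>1. gcd n m = 1 \<longrightarrow> chi n = 1)"

text \<open>The entire extension of the Dirichlet series. It is unique by the identity theorem and
  exists when \<open>chi\<close> is non principal; for principal \<open>chi\<close> the description is void.\<close>

definition dirichlet_L :: "(nat \<Rightarrow> complex) \<Rightarrow> complex \<Rightarrow> complex" where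
  "dirichlet_L chi = (THE f. f holomorphic_on UNIV \<and>
     (\<forall>s. Re s > 1 \<longrightarrow> f s = (\<Sum>n. chi (Suc n) * of_nat (Suc n) powr (- s))))"


section \<open>The space of bounded continuous functions\<close>

text \<open>The type \<open>real ^ 'n \<Rightarrow>\<^sub>C complex\<close> is the set of bounded continuous functions. It is
  not used with its library norm (the supremum of the modulus) but with the maximum of the
  \<open>L\<^sup>\<infinity>\<close> norms of the real and imaginary parts, which for continuous functions are
  suprema.\<close>

type_synonym 'n Y = "(real ^ 'n) \<Rightarrow>\<^sub>C complex"

definition Y_norm :: "'n::finite Y \<Rightarrow> real" where
  "Y_norm f = max (SUP x. \<bar>Re (apply_bcontfun f x)\<bar>) (SUP x. \<bar>Im (apply_bcontfun f x)\<bar>)"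

definition Y_ball :: "'n::finite Y \<Rightarrow> real \<Rightarrow> 'n Y set" where
  "Y_ball g r = {h. Y_norm (h - g) < r}"

definition Y_continuous_on :: "real set \<Rightarrow> (real \<Rightarrow> 'n::finite Y) \<Rightarrow> bool" where
  "Y_continuous_on I u \<longleftrightarrow>
     (\<forall>t\<^sub>0\<in>I. ((\<lambda>t. Y_norm (u t - u t\<^sub>0)) \<longlongrightarrow> 0) (at t\<^sub>0 within I))"


section \<open>Heat semigroup and Duhamel solutions\<close>

definition heat_kernel :: "real \<Rightarrow> real ^ 'n::finite \<Rightarrow> real" where
  "heat_kernel t x = (4 * pi * t) powr (- real CARD('n) / 2) * exp (- (norm x)\<^sup>2 / (4 * t))"

definition heat :: "real \<Rightarrow> (real ^ 'n::finite \<Rightarrow> complex) \<Rightarrow> real ^ 'n \<Rightarrow> complex" where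
  "heat t h x =
     (if t = 0 then h x else (LINT y|lborel. complex_of_real (heat_kernel t (x - y)) * h y))"

text \<open>The equation \<open>u(t) = e\<^bsup>t\<Delta>\<^esup>g + \<lambda> \<integral>\<^sub>0\<^sup>t e\<^bsup>(t-s)\<Delta>\<^esup>F(u(s)) ds\<close>, evaluated pointwise in space.
  At \<open>t = 0\<close> it is the initial condition.\<close>

definition duhamel_solution ::
  "real \<Rightarrow> real \<Rightarrow> (complex \<Rightarrow> complex) \<Rightarrow> 'n::finite Y \<Rightarrow> (real \<Rightarrow> 'n Y) \<Rightarrow> bool" where
  "duhamel_solution T lam F g u \<longleftrightarrow>
     (\<forall>t\<in>{0..<T}. \<forall>x. apply_bcontfun (u t) x =
        heat t (apply_bcontfun g) x +
        complex_of_real lam *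
          (LINT s:{0..t}|lborel. heat (t - s) (\<lambda>y. F (apply_bcontfun (u s) y)) x))"

text \<open>If \<open>u\<close> is a Duhamel solution with datum \<open>g\<close>, bounded near \<open>t = 0\<close>, then
  \<open>u(t) - e\<^bsup>t\<Delta>\<^esup>g\<close> tends to \<open>0\<close> in norm, whereas \<open>e\<^bsup>t\<Delta>\<^esup>g\<close> is uniformly continuous for
  \<open>t > 0\<close>. Hence \<open>u\<close> can be norm continuous at \<open>t = 0\<close> only if \<open>g\<close> is uniformly continuous.
  For arbitrary bounded continuous data, continuity at \<open>t = 0\<close> is therefore taken locally
  uniformly in space, with local-in-time boundedness in norm. The class below contains every
  \<open>u\<close> that is norm continuous on all of \<open>[0,T)\<close>.\<close>

definition solution_class :: "real \<Rightarrow> (real \<Rightarrow> 'n::finite Y) set" where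
  "solution_class T = {u.
     Y_continuous_on {0<..<T} u \<and>
     (\<forall>K. compact K \<longrightarrow>
        uniform_limit K (\<lambda>t. apply_bcontfun (u t)) (apply_bcontfun (u 0)) (at 0 within {0..<T})) \<and>
     (\<forall>T'\<in>{0<..<T}. \<exists>B. \<forall>t\<in>{0..T'}. Y_norm (u t) \<le> B)}"

end

theory Submission
  imports Defs "HOL-Number_Theory.Cong" "HOL-Probability.Distributions"
begin

text \<open>
  Two independent facts combine: \<^term>\<open>dirichlet_L chi\<close> is entire for a non principal
  character, and the heat equation with an entire nonlinearity is locally well posed for bounded
  continuous data.

  \<^emph>\<open>The L-function.\<close> The values of a non principal character form a periodic sequence \<open>f\<close> whose
  sum over a period vanishes. The partial sums of \<open>f\<close> are then periodic again, and after
  subtracting their mean they form another mean-zero periodic sequence. Abel summation replaces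
  \<open>f\<close> by this sequence and \<open>n\<^sup>-\<^sup>s\<close> by its difference \<open>n\<^sup>-\<^sup>s - (n+1)\<^sup>-\<^sup>s\<close>, at the cost of one explicit entire term.
  After \<open>k\<close> rounds the summand is a \<open>k\<close>-fold difference, of size \<open>O(n powr (- Re s - k))\<close>
  locally uniformly in \<open>s\<close>, so the series is holomorphic on \<open>Re s > 1 - k\<close>
  (\<open>holomorphic_abel_continuation\<close>). The
  functions for different \<open>k\<close> agree where both converge and glue to an entire function
  (\<open>periodic_dirichlet_series_entire\<close>).

  \<^emph>\<open>The heat semigroup.\<close> Scaling turns \<open>heat t h x\<close> into the mean of \<open>h (x - sqrt t *\<^sub>R z)\<close> for a
  Gaussian \<open>z\<close>, for every \<open>t \<ge> 0\<close> including \<open>0\<close> (\<open>heat_eq_gauss\<close>). Contractivity and joint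
  continuity in time, space and datum follow by dominated convergence. Norm continuity at positive
  times comes from the bound
  \<open>\<parallel>K\<^sub>a - K\<^sub>b\<parallel>\<^sub>1 \<le> 2 ((b / a) powr (d / 2) - 1)\<close> for \<open>0 < a \<le> b\<close>
  (\<open>heat_kernel_L1_diff\<close>), which also gives the Duhamel integral an explicit modulus of continuity
  in time, uniform in space (\<open>norm_duhamel_int_time_diff_le\<close>).

  \<^emph>\<open>Existence and dependence on the datum.\<close> Composing the nonlinearity with the nearest-point
  projection onto a large disc makes it bounded and globally Lipschitz without changing it on the
  disc. On a short time interval the Duhamel map is then a contraction of the space of bounded
  continuous functions of time and space; the contraction bound also compares the fixed points of
  two data, and for short times the fixed point stays inside the disc, so that it solves the
  original equation.

  \<^emph>\<open>Uniqueness.\<close> On every \<open>[0,T']\<close> with \<open>T' < T\<close> two solutions of the class extend to bounded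
  continuous functions of time and space. Iterating the Duhamel formula shows that they differ by
  at most \<open>C (1/2)\<^sup>n exp (2 L t)\<close> for every \<open>n\<close> (\<open>duhamel_equation_unique\<close>).

  \<^emph>\<open>Continuity at time 0.\<close> The Duhamel integral tends to \<open>0\<close> in norm as \<open>t\<close> tends to \<open>0\<close>, so the
  solution is norm continuous at \<open>0\<close> exactly if \<open>heat t h\<close> tends to \<open>h\<close> uniformly. This holds for
  uniformly continuous \<open>h\<close>, and conversely forces \<open>h\<close> to be uniformly continuous, because
  \<open>heat t h\<close> is so for every \<open>t > 0\<close> (\<open>time_slice_continuous_iff\<close>).
\<close>

section \<open>Iterated differences of a complex power\<close>

primrec powr_diff :: "nat \<Rightarrow> complex \<Rightarrow> real \<Rightarrow> complex" where
  "powr_diff 0 s x = of_real x powr (- s)"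
| "powr_diff (Suc k) s x = powr_diff k s x - powr_diff k s (x + 1)"

lemma holomorphic_powr_diff: "x > 0 \<Longrightarrow> (\<lambda>s. powr_diff k s x) holomorphic_on A"
  by (induction k arbitrary: x) (auto intro!: holomorphic_intros)

lemma powr_diff_has_vector_derivative:
  "x > 0 \<Longrightarrow> (powr_diff k s has_vector_derivative - s * powr_diff k (s + 1) x) (at x within A)"
proof (induction k arbitrary: x A)
  case 0
  have "((\<lambda>z. z powr (- s)) has_field_derivative - s * of_real x powr (- s - 1)) (at (of_real x))"
    using 0 by (intro has_field_derivative_powr) (auto simp: complex_nonpos_Reals_iff)
  from has_vector_derivative_real_field[OF this, of A]
  have "((\<lambda>y. complex_of_real y powr (- s)) has_vector_derivative
      - s * complex_of_real x powr (- s - 1)) (at x within A)" .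
  moreover have "- s - 1 = - (s + 1)" by simp
  ultimately show ?case by (simp only: powr_diff.simps(1)[abs_def])
next
  case (Suc k)
  have shift: "((\<lambda>y. y + 1) has_vector_derivative 1) (at x within A)"
    by (auto intro!: derivative_eq_intros)
  have "(powr_diff k s has_vector_derivative - s * powr_diff k (s + 1) (x + 1)) (at (x + 1) within (\<lambda>y. y + 1) ` A)"
    using Suc.prems by (intro Suc.IH) simp
  from vector_diff_chain_within[OF shift this]
  have "((\<lambda>y. powr_diff k s (y + 1)) has_vector_derivative - s * powr_diff k (s + 1) (x + 1)) (at x within A)"
    by (simp only: o_def scaleR_one)
  from has_vector_derivative_diff[OF Suc.IH[OF Suc.prems] this] show ?case
    by (simp add: powr_diff.simps(2)[abs_def] algebra_simps)
qed

text \<open>The \<open>x\<close>-derivative of the \<open>k\<close>-fold difference with parameter \<open>s\<close> is \<open>- s\<close> times the one with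
parameter \<open>s + 1\<close>, so one more difference costs, by the mean value inequality, a factor \<open>s\<close> and
raises the parameter by one. Since \<open>Re s + (k + 1) = Re (s + 1) + k\<close>, the induction hypothesis
already has the required exponent; as it is not positive, the supremum over \<open>[x, x + 1]\<close> is
attained at \<open>x\<close>.\<close>

lemma norm_powr_diff_le:
  "x > 0 \<Longrightarrow> Re s + real k \<ge> 0 \<Longrightarrow>
     norm (powr_diff k s x) \<le> norm (pochhammer s k) * x powr (- (Re s + real k))"
proof (induction k arbitrary: s x)
  case 0
  then show ?case by (simp add: norm_powr_real_powr)
next
  case (Suc k)
  let ?B = "norm (pochhammer s (Suc k)) * x powr (- (Re s + real (Suc k)))"
  have "norm (powr_diff k s x - powr_diff k s (x + 1)) \<le> ?B * norm (x - (x + 1))"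
  proof (rule differentiable_bound[where S = "{x..x+1}" and f' = "\<lambda>y h. h *\<^sub>R (- s * powr_diff k (s + 1) y)"])
    fix y assume y: "y \<in> {x..x+1}"
    then have "y > 0" using Suc.prems by auto
    then show "(powr_diff k s has_derivative (\<lambda>h. h *\<^sub>R (- s * powr_diff k (s + 1) y))) (at y within {x..x+1})"
      using powr_diff_has_vector_derivative by (simp add: has_vector_derivative_def)
    have "norm (powr_diff k (s + 1) y) \<le> norm (pochhammer (s + 1) k) * y powr (- (Re (s + 1) + real k))"
      using Suc.prems \<open>y > 0\<close> by (intro Suc.IH) auto
    also have "\<dots> \<le> norm (pochhammer (s + 1) k) * x powr (- (Re (s + 1) + real k))"
      using Suc.prems y by (intro mult_left_mono powr_mono2') auto
    finally have "norm s * norm (powr_diff k (s + 1) y)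
        \<le> norm s * (norm (pochhammer (s + 1) k) * x powr (- (Re (s + 1) + real k)))"
      by (rule mult_left_mono) simp
    also have "\<dots> = ?B"
    proof -
      have "Re (s + 1) + real k = Re s + real (Suc k)" by simp
      then show ?thesis by (simp only: pochhammer_rec norm_mult mult.assoc)
    qed
    finally have le: "norm s * norm (powr_diff k (s + 1) y) \<le> ?B" .
    show "onorm (\<lambda>h. h *\<^sub>R (- s * powr_diff k (s + 1) y)) \<le> ?B"
    proof (rule onorm_le)
      fix h :: real
      have "norm (h *\<^sub>R (- s * powr_diff k (s + 1) y)) = norm s * norm (powr_diff k (s + 1) y) * norm h"
        by (simp add: norm_mult)
      also have "\<dots> \<le> ?B * norm h" by (rule mult_right_mono[OF le norm_ge_zero])
      finally show "norm (h *\<^sub>R (- s * powr_diff k (s + 1) y)) \<le> ?B * norm h" .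
    qed
  qed auto
  also have "?B * norm (x - (x + 1)) = ?B" by simp
  finally show ?case unfolding powr_diff.simps(2) .
qed

section \<open>Mean-zero periodic sequences and Abel summation\<close>

definition mean_zero_periodic :: "nat \<Rightarrow> (nat \<Rightarrow> complex) \<Rightarrow> bool" where
  "mean_zero_periodic m f \<longleftrightarrow> m > 0 \<and> (\<forall>n. f (n + m) = f n) \<and> (\<Sum>n<m. f n) = 0"

lemma sum_over_period:
  fixes f :: "nat \<Rightarrow> 'a::ab_group_add"
  assumes "\<And>n. f (n + m) = f n"
  shows "(\<Sum>n<m. f (n + j)) = (\<Sum>n<m. f n)"
proof (induction j)
  case (Suc j)
  have "(\<Sum>n<m. f (n + Suc j)) + f j = (\<Sum>n<Suc m. f (n + j))"
    by (subst sum.lessThan_Suc_shift) simp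
  also have "\<dots> = (\<Sum>n<m. f (n + j)) + f j"
    using assms[of j] by (simp add: add.commute)
  finally show ?case using Suc by simp
qed simp

definition sum_mean :: "nat \<Rightarrow> (nat \<Rightarrow> complex) \<Rightarrow> complex" where
  "sum_mean m f = (\<Sum>n<m. \<Sum>k\<le>n. f k) / of_nat m"

text \<open>Subtracting the mean keeps the partial sums inside the class of mean-zero periodic sequences, so
that Abel summation can be repeated.\<close>

definition centred_sum :: "nat \<Rightarrow> (nat \<Rightarrow> complex) \<Rightarrow> nat \<Rightarrow> complex" where
  "centred_sum m f n = (\<Sum>k\<le>n. f k) - sum_mean m f"

lemma mean_zero_periodic_centred_sum:
  assumes "mean_zero_periodic m f"
  shows "mean_zero_periodic m (centred_sum m f)"
proof -
  have per: "f (n + m) = f n" and zero: "(\<Sum>n<m. f n) = 0" and m: "m > 0" for n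
    using assms by (auto simp: mean_zero_periodic_def)
  have "(\<Sum>k\<le>n + m. f k) = (\<Sum>k\<le>n. f k)" for n
  proof (induction n)
    case 0
    then show ?case using zero per[of 0] by (simp add: lessThan_Suc_atMost[symmetric])
  next
    case (Suc n)
    then show ?case using per[of "Suc n"] by simp
  qed
  moreover have "(\<Sum>n<m. centred_sum m f n) = 0"
    using m by (simp add: centred_sum_def sum_subtractf sum_mean_def)
  ultimately show ?thesis
    using m by (simp add: mean_zero_periodic_def centred_sum_def)
qed

lemma mean_zero_periodic_bounded:
  assumes "mean_zero_periodic m f"
  obtains C where "C > 0" "\<And>n. norm (f n) \<le> C"
proof -
  have per: "f (n + m) = f n" and m: "m > 0" for n
    using assms by (auto simp: mean_zero_periodic_def)
  have red: "f n = f (n mod m)" for n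
  proof (induction n rule: less_induct)
    case (less n)
    show ?case
    proof (cases "n < m")
      case False
      then have "f n = f (n - m)" using per[of "n - m"] by simp
      also have "\<dots> = f ((n - m) mod m)" using less[of "n - m"] m False by auto
      also have "(n - m) mod m = n mod m" using False by (simp add: le_mod_geq)
      finally show ?thesis .
    qed simp
  qed
  have "norm (f n) \<le> (\<Sum>k<m. norm (f k)) + 1" for n
  proof -
    have "norm (f (n mod m)) \<le> (\<Sum>k<m. norm (f k))"
      using m by (intro member_le_sum) auto
    then show ?thesis using red[of n] by simp
  qed
  moreover have "(\<Sum>k<m. norm (f k)) + 1 > 0"
    by (intro add_nonneg_pos sum_nonneg) auto
  ultimately show thesis using that by blast
qed

text \<open>The constant that centring removes from the partial sums is multiplied by a telescoping sum and
leaves \<open>a 0\<close>. The term at \<open>N\<close> carries the centred sum alone, hence is bounded by a multiple of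
\<open>a (Suc N)\<close> and vanishes in the limit.\<close>

lemma abel_step:
  "(\<Sum>n<Suc N. f n * a n) =
     sum_mean m f * a 0 + (\<Sum>n<Suc N. centred_sum m f n * (a n - a (Suc n)))
       + centred_sum m f N * a (Suc N)"
  by (induction N) (simp_all add: centred_sum_def algebra_simps)

section \<open>Entire continuation of periodic Dirichlet series\<close>

primrec iter_centred_sum :: "nat \<Rightarrow> (nat \<Rightarrow> complex) \<Rightarrow> nat \<Rightarrow> nat \<Rightarrow> complex" where
  "iter_centred_sum m f 0 = f"
| "iter_centred_sum m f (Suc k) = centred_sum m (iter_centred_sum m f k)"

text \<open>The Dirichlet series after \<open>k\<close> Abel summations: the entire terms split off so far, and the
remaining series, which converges for \<open>Re s > 1 - k\<close>.\<close>

definition abel_continuation :: "nat \<Rightarrow> (nat \<Rightarrow> complex) \<Rightarrow> nat \<Rightarrow> complex \<Rightarrow> complex" where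
  "abel_continuation m f k s = (\<Sum>j<k. sum_mean m (iter_centred_sum m f j) * powr_diff j s 1)
      + (\<Sum>n. iter_centred_sum m f k n * powr_diff k s (real (Suc n)))"

lemma mean_zero_periodic_iter_centred_sum:
  "mean_zero_periodic m f \<Longrightarrow> mean_zero_periodic m (iter_centred_sum m f k)"
  by (induction k) (auto intro: mean_zero_periodic_centred_sum)

lemma summable_Suc_powr: "a > 1 \<Longrightarrow> summable (\<lambda>n. C * real (Suc n) powr (- a))"
proof (intro summable_mult)
  assume "a > 1"
  then have "summable (\<lambda>n. real n powr (- a))" by (simp add: summable_real_powr_iff)
  then show "summable (\<lambda>n. real (Suc n) powr (- a))" by (subst summable_Suc_iff)
qed

text \<open>The constants \<open>c\<close> and \<open>P\<close> are independent of \<open>s\<close> so that the bound can serve as a majorant on a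
whole disc.\<close>

lemma norm_abel_term_le:
  assumes "\<And>n. norm (f n) \<le> C" "Re s + real k \<ge> c" "c \<ge> 0" "norm (pochhammer s k) \<le> P"
  shows "norm (f n * powr_diff k s (real (Suc n))) \<le> (C * P) * real (Suc n) powr (- c)"
proof -
  have "C \<ge> 0" using assms(1)[of 0] norm_ge_zero order_trans by blast
  have "P \<ge> 0" using order_trans[OF norm_ge_zero assms(4)] .
  have "norm (powr_diff k s (real (Suc n)))
      \<le> norm (pochhammer s k) * real (Suc n) powr (- (Re s + real k))"
    using assms by (intro norm_powr_diff_le) auto
  also have "\<dots> \<le> P * real (Suc n) powr (- c)"
    using assms \<open>P \<ge> 0\<close> by (intro mult_mono powr_mono) auto
  finally show ?thesis
    using assms(1)[of n] \<open>C \<ge> 0\<close> \<open>P \<ge> 0\<close> unfolding norm_mult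
    by (metis mult.assoc mult_mono norm_ge_zero)
qed

lemma summable_abel_term:
  assumes "mean_zero_periodic m f" "Re s + real k > 1"
  shows "summable (\<lambda>n. f n * powr_diff k s (real (Suc n)))"
proof -
  obtain C where C: "\<And>n. norm (f n) \<le> C"
    using mean_zero_periodic_bounded[OF assms(1)] by blast
  show ?thesis
    by (rule summable_comparison_test'[OF summable_Suc_powr[OF assms(2)], of 0])
       (rule norm_abel_term_le[OF C], use assms in auto)
qed

lemma abel_continuation_Suc:
  assumes f: "mean_zero_periodic m f" and s: "Re s + real k > 1"
  shows "abel_continuation m f (Suc k) s = abel_continuation m f k s"
proof -
  define g where "g = iter_centred_sum m f k"
  define a where "a n = powr_diff k s (real (Suc n))" for n
  have g: "mean_zero_periodic m g" unfolding g_def by (rule mean_zero_periodic_iter_centred_sum[OF f])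
  obtain C where C: "\<And>n. norm (centred_sum m g n) \<le> C"
    using mean_zero_periodic_bounded[OF mean_zero_periodic_centred_sum[OF g]] by blast
  have diff: "a n - a (Suc n) = powr_diff (Suc k) s (real (Suc n))" for n
    by (simp add: a_def add.commute)
  have sum1: "(\<lambda>N. \<Sum>n<Suc N. g n * a n) \<longlonglongrightarrow> (\<Sum>n. g n * a n)"
    unfolding a_def by (intro LIMSEQ_Suc summable_LIMSEQ summable_abel_term[OF g s])
  have sum2: "(\<lambda>N. \<Sum>n<Suc N. centred_sum m g n * (a n - a (Suc n)))
      \<longlonglongrightarrow> (\<Sum>n. centred_sum m g n * (a n - a (Suc n)))"
    unfolding diff using s
    by (intro LIMSEQ_Suc summable_LIMSEQ summable_abel_term[OF mean_zero_periodic_centred_sum[OF g]]) simp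
  have "(\<lambda>n. 1 * a n) \<longlonglongrightarrow> 0"
  proof (rule Lim_null_comparison)
    show "\<forall>\<^sub>F n in sequentially. norm (1 * a n)
        \<le> (1 * norm (pochhammer s k)) * real (Suc n) powr (- (Re s + real k))"
      unfolding a_def using s by (intro always_eventually allI norm_abel_term_le) auto
    show "(\<lambda>n. (1 * norm (pochhammer s k)) * real (Suc n) powr (- (Re s + real k))) \<longlonglongrightarrow> 0"
      by (rule summable_LIMSEQ_zero[OF summable_Suc_powr[OF s]])
  qed
  then have "(\<lambda>n. a (Suc n)) \<longlonglongrightarrow> 0" by (intro LIMSEQ_Suc) simp
  then have "(\<lambda>N. centred_sum m g N * a (Suc N)) \<longlonglongrightarrow> 0"
    using C by (intro lim_null_mult_left_bounded[where B = C]) auto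
  then have "(\<lambda>N. \<Sum>n<Suc N. g n * a n) \<longlonglongrightarrow>
      sum_mean m g * a 0 + (\<Sum>n. centred_sum m g n * (a n - a (Suc n))) + 0"
    unfolding abel_step[of g a _ m] by (intro tendsto_intros sum2)
  with sum1 have "(\<Sum>n. g n * a n)
      = sum_mean m g * a 0 + (\<Sum>n. centred_sum m g n * (a n - a (Suc n)))"
    using LIMSEQ_unique by fastforce
  then show ?thesis
    unfolding abel_continuation_def diff by (simp add: g_def a_def del: powr_diff.simps)
qed

lemma holomorphic_abel_continuation:
  assumes f: "mean_zero_periodic m f"
  shows "abel_continuation m f k holomorphic_on {s. Re s + real k > 1}"
proof -
  define g where "g = iter_centred_sum m f k"
  have g: "mean_zero_periodic m g" unfolding g_def by (rule mean_zero_periodic_iter_centred_sum[OF f])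
  obtain C where C: "\<And>n. norm (g n) \<le> C"
    using mean_zero_periodic_bounded[OF g] by blast
  have "(\<lambda>s. \<Sum>n. g n * powr_diff k s (real (Suc n))) holomorphic_on {s. Re s + real k > 1}"
  proof (rule holomorphic_uniform_sequence[where f = "\<lambda>N s. \<Sum>n<N. g n * powr_diff k s (real (Suc n))"])
    have "{s. Re s + real k > 1} = {s. Re s > 1 - real k}" by auto
    then show "open {s. Re s + real k > 1}" by (simp add: open_halfspace_Re_gt)
    show "(\<lambda>s. \<Sum>n<N. g n * powr_diff k s (real (Suc n))) holomorphic_on {s. Re s + real k > 1}" for N
      by (intro holomorphic_intros holomorphic_powr_diff) auto
    fix z assume "z \<in> {s. Re s + real k > 1}"
    then have z: "Re z + real k > 1" by simp
    define d where "d = (Re z + real k - 1) / 2"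
    define c where "c = Re z - d + real k"
    have d: "d > 0" and c: "c > 1" using z by (auto simp: d_def c_def field_simps)
    have re: "Re s + real k \<ge> c" if "s \<in> cball z d" for s
    proof -
      have "Re z - Re s \<le> norm (z - s)" using complex_Re_le_cmod[of "z - s"] by simp
      then show ?thesis using that by (simp add: c_def dist_norm)
    qed
    have "compact ((\<lambda>s. pochhammer s k) ` cball z d)"
      unfolding pochhammer_prod
      by (intro compact_continuous_image continuous_intros) auto
    from compact_imp_bounded[OF this]
    obtain P where P: "\<And>s. s \<in> cball z d \<Longrightarrow> norm (pochhammer s k) \<le> P"
      unfolding bounded_iff by fast
    have "uniform_limit (cball z d) (\<lambda>N s. \<Sum>n<N. g n * powr_diff k s (real (Suc n)))
        (\<lambda>s. \<Sum>n. g n * powr_diff k s (real (Suc n))) sequentially"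
    proof (rule Weierstrass_m_test)
      show "summable (\<lambda>n. (C * P) * real (Suc n) powr (- c))" by (rule summable_Suc_powr[OF c])
      show "norm (g n * powr_diff k s (real (Suc n))) \<le> (C * P) * real (Suc n) powr (- c)"
        if "s \<in> cball z d" for n s
        using C re[OF that] c P[OF that] by (intro norm_abel_term_le) auto
    qed
    moreover have "cball z d \<subseteq> {s. Re s + real k > 1}" using re c by force
    ultimately show "\<exists>d>0. cball z d \<subseteq> {s. Re s + real k > 1} \<and>
        uniform_limit (cball z d) (\<lambda>N s. \<Sum>n<N. g n * powr_diff k s (real (Suc n)))
        (\<lambda>s. \<Sum>n. g n * powr_diff k s (real (Suc n))) sequentially"
      using d by blast
  qed
  then show ?thesis
    unfolding abel_continuation_def[abs_def] g_def by (intro holomorphic_intros holomorphic_powr_diff) auto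
qed

lemma periodic_dirichlet_series_entire:
  assumes f: "mean_zero_periodic m f"
  obtains E where "E holomorphic_on UNIV"
    "\<And>s. Re s > 1 \<Longrightarrow> E s = (\<Sum>n. f n * of_nat (Suc n) powr (- s))"
proof -
  have continuation_add: "abel_continuation m f (k + j) s = abel_continuation m f k s" if "Re s + real k > 1" for k j s
  proof (induction j)
    case (Suc j)
    have "abel_continuation m f (Suc (k + j)) s = abel_continuation m f (k + j) s" using that by (intro abel_continuation_Suc[OF f]) simp
    with Suc show ?case by simp
  qed simp
  have continuation_eq: "abel_continuation m f k s = abel_continuation m f j s" if "Re s + real k > 1" "Re s + real j > 1" for k j s
    using continuation_add[OF that(1), of "j - k"] continuation_add[OF that(2), of "k - j"] by (cases "k \<le> j") auto
  \<comment> \<open>enough summations for convergence at \<open>s\<close>; any larger number gives the same value\<close>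
  define K where "K s = nat (\<lceil>2 - Re s\<rceil>)" for s
  have K: "Re s + real (K s) > 1" for s unfolding K_def by linarith
  define E where "E s = abel_continuation m f (K s) s" for s
  have "E holomorphic_on (\<Union>k\<in>UNIV. {s. Re s + real k > 1})"
  proof (rule holomorphic_on_UN_open)
    fix k :: nat
    show "E holomorphic_on {s. Re s + real k > 1}"
      by (rule holomorphic_transform[OF holomorphic_abel_continuation[OF f]]) (simp add: E_def continuation_eq[OF _ K])
    have "{s. Re s + real k > 1} = {s. Re s > 1 - real k}" by auto
    then show "open {s. Re s + real k > 1}" by (simp add: open_halfspace_Re_gt)
  qed
  moreover have "(\<Union>k\<in>UNIV. {s. Re s + real k > 1}) = UNIV" using K by blast
  moreover have "E s = (\<Sum>n. f n * of_nat (Suc n) powr (- s))" if "Re s > 1" for s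
    using continuation_eq[OF K[of s], of 0] that by (simp add: E_def abel_continuation_def)
  ultimately show thesis using that[of E] by simp
qed

section \<open>Dirichlet L-functions\<close>

text \<open>Multiplication by a unit \<open>a\<close> with \<open>chi a \<noteq> 1\<close> permutes the residues modulo \<open>m\<close>, so the sum \<open>S\<close> over
a period satisfies \<open>chi a * S = S\<close>. Residues are represented by \<open>m, ..., 2 m - 1\<close>, because the
value of the character at \<open>0\<close> is arbitrary.\<close>

lemma mean_zero_periodic_character:
  assumes chi: "dirichlet_character m chi" and np: "\<not> principal_character m chi"
  shows "mean_zero_periodic m (\<lambda>n. chi (Suc n))"
proof -
  have m: "m > 0" and per: "\<And>n. n \<ge> 1 \<Longrightarrow> chi (n + m) = chi n"
    and mult: "\<And>a b. a \<ge> 1 \<Longrightarrow> b \<ge> 1 \<Longrightarrow> chi (a * b) = chi a * chi b"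
    using chi by (auto simp: dirichlet_character_def)
  obtain a where a: "a \<ge> 1" "coprime a m" "chi a \<noteq> 1"
    using np by (auto simp: principal_character_def coprime_iff_gcd_eq_1)
  have shift: "chi (n + q * m) = chi n" if "n \<ge> 1" for n q
  proof (induction q)
    case (Suc q)
    then show ?case using per[of "n + q * m"] that by (simp add: algebra_simps)
  qed simp
  have red: "chi n = chi (n mod m + m)" if "n \<ge> 1" for n
  proof -
    have "chi n = chi (n + m)" using per that by simp
    also have "n + m = (n mod m + m) + (n div m) * m" by simp
    also have "chi \<dots> = chi (n mod m + m)" using m by (intro shift) simp
    finally show ?thesis .
  qed
  have inj: "inj_on (\<lambda>n. (a * n) mod m) {..<m}"
  proof (rule inj_onI)
    fix x y assume xy: "x \<in> {..<m}" "y \<in> {..<m}" "(a * x) mod m = (a * y) mod m"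
    then have "[x = y] (mod m)" using a(2) by (simp add: cong_def[symmetric] cong_mult_lcancel_nat)
    with xy show "x = y" by (simp add: cong_def)
  qed
  have img: "(\<lambda>n. (a * n) mod m) ` {..<m} = {..<m}"
    using m inj by (intro endo_inj_surj) auto
  define S where "S = (\<Sum>n<m. chi (n + m))"
  have "chi a * S = (\<Sum>n<m. chi ((a * n) mod m + m))"
    unfolding S_def sum_distrib_left
  proof (rule sum.cong)
    fix n assume "n \<in> {..<m}"
    have "chi a * chi (n + m) = chi (a * (n + m))" using mult a m by simp
    also have "\<dots> = chi ((a * (n + m)) mod m + m)" using a m by (intro red) simp
    also have "(a * (n + m)) mod m = (a * n) mod m" by (simp add: distrib_left)
    finally show "chi a * chi (n + m) = chi ((a * n) mod m + m)" .
  qed simp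
  also have "\<dots> = S"
    unfolding S_def by (subst (2) img[symmetric], subst sum.reindex[OF inj]) simp
  finally have "S = 0" using a(3) by (simp add: mult_cancel_right1)
  have per': "chi (Suc (n + m)) = chi (Suc n)" for n using per[of "Suc n"] by simp
  have "(\<Sum>n<m. chi (Suc n)) = (\<Sum>n<m. chi (Suc (n + (m - 1))))"
    using sum_over_period[of "\<lambda>n. chi (Suc n)" m "m - 1"] per' by simp
  also have "\<dots> = S" unfolding S_def using m by simp
  finally show ?thesis
    using m per' \<open>S = 0\<close> by (simp add: mean_zero_periodic_def)
qed

lemma dirichlet_L_entire:
  assumes "dirichlet_character m chi" "\<not> principal_character m chi"
  shows "dirichlet_L chi holomorphic_on UNIV"
proof -
  let ?P = "\<lambda>f. f holomorphic_on UNIV \<and>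
     (\<forall>s. Re s > 1 \<longrightarrow> f s = (\<Sum>n. chi (Suc n) * of_nat (Suc n) powr (- s)))"
  obtain E where E: "?P E"
    using periodic_dirichlet_series_entire[OF mean_zero_periodic_character[OF assms]] by metis
  have "?P (THE f. ?P f)"
  proof (rule theI[of ?P, OF E])
    fix f assume f: "?P f"
    show "f = E"
    proof
      fix z
      show "f z = E z"
      proof (rule analytic_continuation_open[where s = "{s. Re s > 1}" and s' = UNIV and g = E])
        show "{s. Re s > 1} \<noteq> {}" by (auto intro!: exI[of _ 2])
      qed (use E f in \<open>auto simp: open_halfspace_Re_gt\<close>)
    qed
  qed
  then show ?thesis unfolding dirichlet_L_def by blast
qed

section \<open>The heat kernel\<close>

lemma heat_kernel_nonneg [simp]: "heat_kernel t x \<ge> 0"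
  by (simp add: heat_kernel_def)

lemma continuous_on_heat_kernel: "continuous_on A (heat_kernel t)"
  unfolding heat_kernel_def[abs_def] by (cases "t = 0") (auto intro!: continuous_intros)

lemma borel_measurable_heat_kernel [measurable]: "heat_kernel t \<in> borel_measurable borel"
  by (intro borel_measurable_continuous_onI continuous_on_heat_kernel)

text \<open>The kernel at time \<open>t\<close> is the density of independent normal variables of variance \<open>2 t\<close>, which
reduces its total mass to the one-dimensional Gaussian integral.\<close>

lemma heat_kernel_eq_prod:
  fixes x :: "real ^ 'n::finite"
  assumes "t > 0"
  shows "heat_kernel t x = (\<Prod>b\<in>Basis. normal_density 0 (sqrt (2 * t)) (x \<bullet> b))"
proof -
  have "(norm x)\<^sup>2 = (\<Sum>b\<in>Basis. (x \<bullet> b)\<^sup>2)"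
    unfolding power2_norm_eq_inner euclidean_inner[of x x] by (simp add: power2_eq_square)
  then have "exp (- (norm x)\<^sup>2 / (4 * t)) = (\<Prod>b\<in>Basis. exp (- (x \<bullet> b)\<^sup>2 / (4 * t)))"
    by (simp add: exp_sum[symmetric] sum_divide_distrib[symmetric] sum_negf)
  moreover have "(4 * pi * t) powr (- real CARD('n) / 2) = (1 / sqrt (4 * pi * t)) ^ CARD('n)"
  proof -
    have c: "4 * pi * t > 0" using assms by simp
    have "1 / sqrt (4 * pi * t) = (4 * pi * t) powr (- (1 / 2))"
      using c by (simp only: powr_minus powr_half_sqrt inverse_eq_divide)
    then have "(1 / sqrt (4 * pi * t)) ^ CARD('n) = ((4 * pi * t) powr (- (1 / 2))) powr real CARD('n)"
      using c by (simp only: powr_realpow powr_gt_zero)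
    then show ?thesis by (simp only: powr_powr) simp
  qed
  moreover have "normal_density 0 (sqrt (2 * t)) y = 1 / sqrt (4 * pi * t) * exp (- y\<^sup>2 / (4 * t))" for y
    using assms by (simp add: normal_density_def mult.assoc mult.left_commute)
  ultimately show ?thesis
    by (simp only: heat_kernel_def prod.distrib prod_constant DIM_cart DIM_real mult_1_right)
qed

lemma nn_integral_heat_kernel:
  assumes "t > 0"
  shows "(\<integral>\<^sup>+x. ennreal (heat_kernel t (x :: real ^ 'n::finite)) \<partial>lborel) = 1"
proof -
  let ?N = "\<lambda>x. ennreal (normal_density 0 (sqrt (2 * t)) x)"
  have one: "(\<integral>\<^sup>+x. ?N x \<partial>lborel) = 1"
    using assms
    by (subst nn_integral_eq_integral) (auto simp: integral_normal_density integrable_normal_density)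
  have "(\<integral>\<^sup>+x. ennreal (heat_kernel t (x :: real ^ 'n)) \<partial>lborel)
      = (\<integral>\<^sup>+x. (\<Prod>b\<in>(Basis :: (real ^ 'n) set). ?N (x \<bullet> b)) \<partial>lborel)"
    using assms by (simp add: heat_kernel_eq_prod prod_ennreal)
  also have "\<dots> = 1"
    by (subst nn_integral_lborel_prod) (auto simp: one)
  finally show ?thesis .
qed

lemma has_bochner_integral_heat_kernel:
  "t > 0 \<Longrightarrow> has_bochner_integral lborel (heat_kernel t :: real ^ 'n::finite \<Rightarrow> real) 1"
  by (rule has_bochner_integral_nn_integral) (auto simp: nn_integral_heat_kernel)

lemma integrable_heat_kernel:
  "t > 0 \<Longrightarrow> integrable lborel (heat_kernel t :: real ^ 'n::finite \<Rightarrow> real)"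
  using has_bochner_integral_heat_kernel by (rule integrable.intros)

lemma integral_heat_kernel:
  "t > 0 \<Longrightarrow> integral\<^sup>L lborel (heat_kernel t :: real ^ 'n::finite \<Rightarrow> real) = 1"
  using has_bochner_integral_heat_kernel by (rule has_bochner_integral_integral_eq)

lemma distr_lborel_reflect:
  fixes x :: "'a::euclidean_space"
  shows "distr lborel borel (\<lambda>y. x - y) = lborel"
  by (subst (2) lborel_affine[of "-1" x]) (auto simp: density_1)

lemma
  fixes f :: "'a::euclidean_space \<Rightarrow> 'b::{banach, second_countable_topology}"
  assumes [measurable]: "f \<in> borel_measurable borel"
  shows integrable_lborel_reflect: "integrable lborel (\<lambda>y. f (x - y)) \<longleftrightarrow> integrable lborel f"
    and integral_lborel_reflect: "(LINT y|lborel. f (x - y)) = (LINT y|lborel. f y)"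
proof -
  have "integrable (distr lborel borel (\<lambda>y. x - y)) f \<longleftrightarrow> integrable lborel (\<lambda>y. f (x - y))"
    by (rule integrable_distr_eq) auto
  then show "integrable lborel (\<lambda>y. f (x - y)) \<longleftrightarrow> integrable lborel f"
    by (simp add: distr_lborel_reflect)
  have "integral\<^sup>L (distr lborel borel (\<lambda>y. x - y)) f = (LINT y|lborel. f (x - y))"
    by (rule integral_distr) auto
  then show "(LINT y|lborel. f (x - y)) = (LINT y|lborel. f y)"
    by (simp add: distr_lborel_reflect)
qed

text \<open>The law of \<open>(X - x) / sqrt t\<close> when \<open>X\<close> has density \<open>K\<^sub>t(x - _)\<close>.\<close>

definition gauss :: "(real ^ 'n::finite) measure" where
  "gauss = density lborel (\<lambda>z. ennreal (heat_kernel 1 z))"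

lemma sets_gauss [measurable_cong, simp]: "sets gauss = sets borel"
  and space_gauss [simp]: "space gauss = UNIV"
  by (auto simp: gauss_def)

interpretation gauss: prob_space gauss
  by (rule prob_spaceI) (simp add: gauss_def emeasure_density nn_integral_heat_kernel)

text \<open>In this form the time \<open>t\<close> has moved from the singular kernel into the argument of \<open>h\<close>, and \<open>t = 0\<close>
is no longer exceptional.\<close>

lemma heat_eq_gauss:
  assumes h: "continuous_on UNIV h" and t: "t \<ge> 0"
  shows "heat t h x = (LINT z|gauss. h (x - sqrt t *\<^sub>R z))"
proof (cases "t = 0")
  case True
  then show ?thesis by (simp add: heat_def gauss.prob_space[unfolded space_gauss])
next
  case False
  with t have t: "t > 0" by simp
  have [measurable]: "h \<in> borel_measurable borel"
    by (rule borel_measurable_continuous_onI[OF h])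
  let ?T = "\<lambda>z. x + (- sqrt t) *\<^sub>R z"
  let ?f = "\<lambda>y. complex_of_real (heat_kernel t (x - y)) * h y"
  have scale: "sqrt t ^ CARD('a) * heat_kernel t (sqrt t *\<^sub>R z) = heat_kernel 1 z" for z :: "real ^ 'a"
  proof -
    have "sqrt t ^ CARD('a) = t powr (real CARD('a) / 2)"
      using t by (simp add: powr_half_sqrt[symmetric] powr_powr powr_realpow[symmetric])
    then show ?thesis
      using t by (simp add: heat_kernel_def powr_mult power_mult_distrib powr_minus field_simps)
  qed
  have "heat t h x = integral\<^sup>L lborel ?f" using t by (simp add: heat_def)
  also have "\<dots> = integral\<^sup>L (density (distr lborel borel ?T) (\<lambda>_. ennreal (sqrt t ^ CARD('a)))) ?f"
    using t by (subst lborel_affine[of "- sqrt t" x]) auto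
  also have "\<dots> = (LINT z|lborel. sqrt t ^ CARD('a) *\<^sub>R ?f (?T z))"
    using t by (simp add: integral_density integral_distr)
  also have "\<dots> = (LINT z|lborel. heat_kernel 1 z *\<^sub>R h (x - sqrt t *\<^sub>R z))"
  proof (rule Bochner_Integration.integral_cong[OF refl])
    fix z
    have "sqrt t ^ CARD('a) *\<^sub>R ?f (?T z)
        = (sqrt t ^ CARD('a) * heat_kernel t (sqrt t *\<^sub>R z)) *\<^sub>R h (x - sqrt t *\<^sub>R z)"
      by (simp add: scaleR_conv_of_real)
    then show "sqrt t ^ CARD('a) *\<^sub>R ?f (?T z) = heat_kernel 1 z *\<^sub>R h (x - sqrt t *\<^sub>R z)"
      by (simp only: scale)
  qed
  also have "\<dots> = (LINT z|gauss. h (x - sqrt t *\<^sub>R z))"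
    unfolding gauss_def by (subst integral_density) auto
  finally show ?thesis .
qed

lemma integrable_gauss:
  fixes h :: "real ^ 'n::finite \<Rightarrow> complex"
  assumes "continuous_on UNIV h" "\<And>y. norm (h y) \<le> M"
  shows "integrable gauss (\<lambda>z. h (x - c *\<^sub>R z))"
proof -
  have [measurable]: "h \<in> borel_measurable borel"
    by (rule borel_measurable_continuous_onI[OF assms(1)])
  show ?thesis
    using assms(2) by (intro gauss.integrable_const_bound[of _ M]) auto
qed

lemma norm_heat_le:
  assumes "continuous_on UNIV h" "\<And>y. norm (h y) \<le> M" "t \<ge> 0"
  shows "norm (heat t h x) \<le> M"
proof -
  have "norm (LINT z|gauss. h (x - sqrt t *\<^sub>R z)) \<le> (LINT z|gauss. norm (h (x - sqrt t *\<^sub>R z)))"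
    by (rule integral_norm_bound)
  also have "\<dots> \<le> (LINT z|(gauss :: (real ^ 'a) measure). M)"
    using assms by (intro integral_mono integrable_norm integrable_gauss) auto
  finally show ?thesis
    using assms by (simp add: heat_eq_gauss gauss.prob_space[unfolded space_gauss])
qed

lemma heat_diff:
  assumes "continuous_on UNIV h" "\<And>y. norm (h y) \<le> M"
    and "continuous_on UNIV k" "\<And>y. norm (k y) \<le> N" "t \<ge> 0"
  shows "heat t (\<lambda>y. h y - k y) x = heat t h x - heat t k x"
proof -
  have "continuous_on UNIV (\<lambda>y. h y - k y)" using assms by (intro continuous_intros)
  then show ?thesis
    using assms(1,3,5) integrable_gauss[OF assms(1,2)] integrable_gauss[OF assms(3,4)]
    by (simp add: heat_eq_gauss)
qed

lemma norm_heat_diff_le: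
  assumes "continuous_on UNIV h" "\<And>y. norm (h y) \<le> M"
    and "continuous_on UNIV k" "\<And>y. norm (k y) \<le> N" "t \<ge> 0"
    and "\<And>y. norm (h y - k y) \<le> d"
  shows "norm (heat t h x - heat t k x) \<le> d"
  unfolding heat_diff[OF assms(1-5), symmetric]
  using assms by (intro norm_heat_le continuous_intros) auto

lemma heat_tendsto:
  fixes H :: "real \<times> (real ^ 'n::finite) \<Rightarrow> complex"
  assumes H: "continuous_on UNIV H" "\<And>p. norm (H p) \<le> M"
    and lim: "\<sigma> \<longlonglongrightarrow> s" "\<tau> \<longlonglongrightarrow> t" "X \<longlonglongrightarrow> x" and nonneg: "\<And>n. \<tau> n \<ge> 0"
  shows "(\<lambda>n. heat (\<tau> n) (\<lambda>y. H (\<sigma> n, y)) (X n)) \<longlonglongrightarrow> heat t (\<lambda>y. H (s, y)) x"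
proof -
  have t: "t \<ge> 0" using LIMSEQ_le_const[OF lim(2)] nonneg by blast
  have slice: "continuous_on UNIV (\<lambda>y. H (r, y))" for r
    by (intro continuous_on_compose2[OF H(1)] continuous_intros) auto
  have [measurable]: "(\<lambda>y. H (r, y)) \<in> borel_measurable borel" for r
    by (rule borel_measurable_continuous_onI[OF slice])
  have "(\<lambda>n. LINT z|gauss. H (\<sigma> n, X n - sqrt (\<tau> n) *\<^sub>R z))
      \<longlonglongrightarrow> (LINT z|gauss. H (s, x - sqrt t *\<^sub>R z))"
  proof (rule integral_dominated_convergence[where w = "\<lambda>_. M"])
    show "AE z in gauss. (\<lambda>n. H (\<sigma> n, X n - sqrt (\<tau> n) *\<^sub>R z)) \<longlonglongrightarrow> H (s, x - sqrt t *\<^sub>R z)"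
    proof (rule AE_I2)
      fix z :: "real ^ 'n"
      show "(\<lambda>n. H (\<sigma> n, X n - sqrt (\<tau> n) *\<^sub>R z)) \<longlonglongrightarrow> H (s, x - sqrt t *\<^sub>R z)"
        by (rule continuous_on_tendsto_compose[OF H(1)]) (auto intro!: tendsto_intros lim)
    qed
  qed (use H in auto)
  then show ?thesis using slice nonneg t by (simp add: heat_eq_gauss)
qed

lemma heat_kernel_le_scaled:
  assumes "0 < a" "a \<le> b"
  shows "heat_kernel a (x :: real ^ 'n::finite) \<le> (b / a) powr (real CARD('n) / 2) * heat_kernel b x"
proof -
  let ?p = "real CARD('n) / 2"
  have "(4 * pi * a) powr (- ?p) = (b / a) powr ?p * (4 * pi * b) powr (- ?p)"
    using assms by (simp add: powr_mult powr_divide powr_minus field_simps)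
  moreover have "exp (- (norm x)\<^sup>2 / (4 * a)) \<le> exp (- (norm x)\<^sup>2 / (4 * b))"
    using assms by (simp add: frac_le)
  ultimately show ?thesis
    unfolding heat_kernel_def minus_divide_left[symmetric]
    by (simp add: mult_left_mono mult.assoc)
qed

text \<open>Both kernels have mass \<open>1\<close>, so the \<open>L\<^sup>1\<close> distance is twice the integral of the positive part of
\<open>K\<^sub>a - K\<^sub>b\<close>, and \<open>K\<^sub>a \<le> r K\<^sub>b\<close> with \<open>r = (b / a) powr (d / 2)\<close> bounds that part by \<open>(r - 1) K\<^sub>b\<close>.\<close>

lemma heat_kernel_L1_diff:
  assumes "0 < a" "a \<le> b"
  shows "(LINT x|lborel. \<bar>heat_kernel a x - heat_kernel b (x :: real ^ 'n::finite)\<bar>)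
      \<le> 2 * ((b / a) powr (real CARD('n) / 2) - 1)"
proof -
  let ?r = "(b / a) powr (real CARD('n) / 2)"
  let ?g = "\<lambda>x :: real ^ 'n. 2 * (?r - 1) * heat_kernel b x - (heat_kernel a x - heat_kernel b x)"
  have b: "b > 0" using assms by simp
  note int = integrable_heat_kernel[OF assms(1), where 'n = 'n] integrable_heat_kernel[OF b, where 'n = 'n]
  have r: "?r \<ge> 1" using assms by (intro ge_one_powr_ge_zero) auto
  have "(LINT x|lborel. \<bar>heat_kernel a x - heat_kernel b (x :: real ^ 'n)\<bar>) \<le> integral\<^sup>L lborel ?g"
  proof (rule integral_mono)
    fix x :: "real ^ 'n"
    have "(?r - 1) * heat_kernel b x \<ge> 0" using r by simp
    then show "\<bar>heat_kernel a x - heat_kernel b x\<bar> \<le> ?g x"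
      using heat_kernel_le_scaled[OF assms, of x] by (simp add: algebra_simps abs_if)
  qed (use int in auto)
  also have "integral\<^sup>L lborel ?g = 2 * (?r - 1)"
    using int assms b by (simp add: integral_heat_kernel)
  finally show ?thesis .
qed

lemma heat_eq_convolution:
  assumes "continuous_on UNIV h" "t > 0"
  shows "heat t h x = (LINT y|lborel. complex_of_real (heat_kernel t y) * h (x - y))"
proof -
  have [measurable]: "h \<in> borel_measurable borel"
    by (rule borel_measurable_continuous_onI[OF assms(1)])
  show ?thesis
    using integral_lborel_reflect[of "\<lambda>y. complex_of_real (heat_kernel t (x - y)) * h y" x] assms(2)
    by (simp add: heat_def)
qed

lemma norm_integral_kernel_diff_le:
  fixes p q :: "real ^ 'n::finite \<Rightarrow> real" and h :: "real ^ 'n \<Rightarrow> complex"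
  assumes p: "integrable lborel p" and q: "integrable lborel q"
    and h[measurable]: "h \<in> borel_measurable borel" and M: "\<And>y. norm (h y) \<le> M"
  shows "norm ((LINT y|lborel. of_real (p y) * h y) - (LINT y|lborel. of_real (q y) * h y))
      \<le> M * (LINT y|lborel. \<bar>p y - q y\<bar>)"
proof -
  have int: "integrable lborel (\<lambda>y. of_real (r y) * h y)" if "integrable lborel r" for r :: "real ^ 'n \<Rightarrow> real"
  proof (rule Bochner_Integration.integrable_bound)
    show "integrable lborel (\<lambda>y. M * r y)" using that by simp
    have "M \<ge> 0" using M norm_ge_zero order_trans by blast
    then show "AE y in lborel. norm (of_real (r y) * h y) \<le> norm (M * r y)"
      using mult_left_mono[OF M abs_ge_zero]
      by (intro AE_I2) (simp add: norm_mult abs_mult mult.commute[of M])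
    have [measurable]: "r \<in> borel_measurable borel" using that by (simp add: borel_measurable_integrable)
    show "(\<lambda>y. of_real (r y) * h y) \<in> borel_measurable lborel" by simp
  qed
  have "(LINT y|lborel. of_real (p y) * h y) - (LINT y|lborel. of_real (q y) * h y)
      = (LINT y|lborel. of_real (p y - q y) * h y)"
    using int[OF p] int[OF q] by (simp add: algebra_simps)
  also have "norm \<dots> \<le> (LINT y|lborel. norm (of_real (p y - q y) * h y))"
    by (rule integral_norm_bound)
  also have "\<dots> \<le> (LINT y|lborel. M * \<bar>p y - q y\<bar>)"
  proof (rule integral_mono)
    show "integrable lborel (\<lambda>y. norm (of_real (p y - q y) * h y))"
      by (intro integrable_norm int Bochner_Integration.integrable_diff p q)
    show "integrable lborel (\<lambda>y. M * \<bar>p y - q y\<bar>)" using p q by simp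
    show "norm (of_real (p y - q y) * h y) \<le> M * \<bar>p y - q y\<bar>" for y
      unfolding norm_mult norm_of_real using M[of y] by (simp add: mult.commute mult_right_mono)
  qed
  finally show ?thesis by simp
qed

lemma norm_heat_time_diff_le:
  fixes h :: "real ^ 'n::finite \<Rightarrow> complex"
  assumes h: "continuous_on UNIV h" "\<And>y. norm (h y) \<le> M" and ab: "0 < a" "a \<le> b"
  shows "norm (heat b h x - heat a h x) \<le> M * (2 * ((b / a) powr (real CARD('n) / 2) - 1))"
proof -
  have b: "b > 0" using ab by simp
  have M: "M \<ge> 0" using h(2) norm_ge_zero order_trans by blast
  have [measurable]: "h \<in> borel_measurable borel"
    by (rule borel_measurable_continuous_onI[OF h(1)])
  have "norm (heat b h x - heat a h x) = norm (heat a h x - heat b h x)"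
    by (rule norm_minus_commute)
  also have "\<dots> \<le> M * (LINT y|lborel. \<bar>heat_kernel a y - heat_kernel b (y :: real ^ 'n)\<bar>)"
    unfolding heat_eq_convolution[OF h(1) ab(1)] heat_eq_convolution[OF h(1) b]
    using integrable_heat_kernel[OF ab(1)] integrable_heat_kernel[OF b] h(2)
    by (intro norm_integral_kernel_diff_le) auto
  also have "\<dots> \<le> M * (2 * ((b / a) powr (real CARD('n) / 2) - 1))"
    using M heat_kernel_L1_diff[OF ab] by (intro mult_left_mono)
  finally show ?thesis .
qed

lemma heat_tendsto_time:
  fixes h :: "real ^ 'n::finite \<Rightarrow> complex"
  assumes h: "continuous_on UNIV h" "\<And>y. norm (h y) \<le> M" and t: "t > 0" and \<tau>: "\<tau> \<longlonglongrightarrow> t"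
  shows "(\<lambda>n. heat (\<tau> n) h (X n) - heat t h (X n)) \<longlonglongrightarrow> 0"
proof (rule Lim_null_comparison)
  let ?p = "real CARD('n) / 2"
  have "(\<lambda>n. M * (2 * ((max (\<tau> n) t / min (\<tau> n) t) powr ?p - 1))) \<longlonglongrightarrow>
      M * (2 * ((max t t / min t t) powr ?p - 1))"
    using t by (intro tendsto_intros tendsto_max tendsto_min \<tau>) auto
  then show "(\<lambda>n. M * (2 * ((max (\<tau> n) t / min (\<tau> n) t) powr ?p - 1))) \<longlonglongrightarrow> 0"
    using t by simp
  show "\<forall>\<^sub>F n in sequentially. norm (heat (\<tau> n) h (X n) - heat t h (X n))
      \<le> M * (2 * ((max (\<tau> n) t / min (\<tau> n) t) powr ?p - 1))"
    using order_tendstoD(1)[OF \<tau> t]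
  proof eventually_elim
    case (elim n)
    show ?case
    proof (cases "\<tau> n \<le> t")
      case True
      then show ?thesis
        using norm_heat_time_diff_le[OF h elim True, of "X n"]
        by (simp add: norm_minus_commute max_def min_def split: if_splits)
    next
      case False
      then show ?thesis
        using norm_heat_time_diff_le[OF h t, of "\<tau> n" "X n"] by simp
    qed
  qed
qed

text \<open>Scheffe's lemma: the shifted kernels converge pointwise and all have mass \<open>1\<close>.\<close>

lemma heat_kernel_shift_tendsto_L1:
  fixes v :: "nat \<Rightarrow> real ^ 'n::finite"
  assumes t: "t > 0" and v: "v \<longlonglongrightarrow> 0"
  shows "(\<lambda>n. LINT y|lborel. \<bar>heat_kernel t (y + v n) - heat_kernel t y\<bar>) \<longlonglongrightarrow> 0"
proof -
  let ?K = "heat_kernel t :: real ^ 'n \<Rightarrow> real"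
  have shift: "distr lborel borel (\<lambda>y. y + c) = (lborel :: (real ^ 'n) measure)" for c
    using lborel_distr_plus[of c] by (simp only: add.commute[of _ c])
  have int: "integrable lborel (\<lambda>y. ?K (y + c))" for c
    using integrable_heat_kernel[OF t, where 'n = 'n]
    by (subst (asm) shift[of c, symmetric], subst (asm) integrable_distr_eq) auto
  have nn: "(\<integral>\<^sup>+y. ennreal (norm (?K (y + c))) \<partial>lborel) = 1" for c
    using nn_integral_heat_kernel[OF t, where 'n = 'n]
    by (subst (asm) shift[of c, symmetric], subst (asm) nn_integral_distr) auto
  have "(\<lambda>n. \<integral>\<^sup>+y. ennreal (norm (?K (y + v n) - ?K y)) \<partial>lborel) \<longlonglongrightarrow> 0"
  proof (rule Scheffe_lemma1)
    show "AE y in lborel. (\<lambda>n. ?K (y + v n)) \<longlonglongrightarrow> ?K y"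
    proof (rule AE_I2)
      fix y
      have "(\<lambda>n. y + v n) \<longlonglongrightarrow> y + 0" by (intro tendsto_intros v)
      then show "(\<lambda>n. ?K (y + v n)) \<longlonglongrightarrow> ?K y"
        by (intro continuous_on_tendsto_compose[OF continuous_on_heat_kernel[of UNIV t]]) auto
    qed
    show "limsup (\<lambda>n. \<integral>\<^sup>+y. ennreal (norm (?K (y + v n))) \<partial>lborel)
        \<le> (\<integral>\<^sup>+y. ennreal (norm (?K y)) \<partial>lborel)"
      using nn[of 0] by (simp only: nn add_0_right Limsup_const[OF sequentially_bot])
  qed (use int int[of 0] in auto)
  moreover have "(\<integral>\<^sup>+y. ennreal (norm (?K (y + v n) - ?K y)) \<partial>lborel)
      = ennreal (LINT y|lborel. \<bar>?K (y + v n) - ?K y\<bar>)" for n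
    using int[of "v n"] int[of 0] by (subst nn_integral_eq_integral) auto
  ultimately have "(\<lambda>n. ennreal (LINT y|lborel. \<bar>?K (y + v n) - ?K y\<bar>)) \<longlonglongrightarrow> ennreal 0"
    by simp
  then show ?thesis by (rule tendsto_ennrealD) auto
qed

lemma uniformly_continuous_heat:
  fixes h :: "real ^ 'n::finite \<Rightarrow> complex"
  assumes h: "continuous_on UNIV h" "\<And>y. norm (h y) \<le> M" and t: "t > 0"
  shows "uniformly_continuous_on UNIV (heat t h)"
  unfolding uniformly_continuous_on_sequentially
proof safe
  fix X Y :: "nat \<Rightarrow> real ^ 'n"
  assume XY: "(\<lambda>n. dist (X n) (Y n)) \<longlonglongrightarrow> 0"
  have hm[measurable]: "h \<in> borel_measurable borel"
    by (rule borel_measurable_continuous_onI[OF h(1)])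
  let ?d = "\<lambda>n. LINT y|lborel. \<bar>heat_kernel t (y + (X n - Y n)) - heat_kernel t y\<bar>"
  have le: "dist (heat t h (X n)) (heat t h (Y n)) \<le> M * ?d n" for n
  proof -
    have int: "integrable lborel (\<lambda>y. heat_kernel t (c - y))" for c :: "real ^ 'n"
      using integrable_heat_kernel[OF t] by (subst integrable_lborel_reflect) auto
    have "dist (heat t h (X n)) (heat t h (Y n))
        \<le> M * (LINT y|lborel. \<bar>heat_kernel t (X n - y) - heat_kernel t (Y n - y)\<bar>)"
      using norm_integral_kernel_diff_le[OF int int hm h(2), of "X n" "Y n"] t
      by (simp add: heat_def dist_norm)
    also have "(LINT y|lborel. \<bar>heat_kernel t (X n - y) - heat_kernel t (Y n - y)\<bar>) = ?d n"
      using integral_lborel_reflect[of "\<lambda>y. \<bar>heat_kernel t (y + (X n - Y n)) - heat_kernel t y\<bar>" "Y n"]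
      by (simp add: algebra_simps)
    finally show ?thesis .
  qed
  have "(\<lambda>n. X n - Y n) \<longlonglongrightarrow> 0"
    using XY by (simp add: dist_norm tendsto_norm_zero_iff)
  then have "?d \<longlonglongrightarrow> 0" by (rule heat_kernel_shift_tendsto_L1[OF t])
  then have "(\<lambda>n. M * ?d n) \<longlonglongrightarrow> 0" by (rule tendsto_mult_right_zero)
  then show "(\<lambda>n. dist (heat t h (X n)) (heat t h (Y n))) \<longlonglongrightarrow> 0"
    by (rule Lim_null_comparison[rotated]) (use le in auto)
qed

text \<open>The points \<open>X n\<close> are arbitrary, which makes this uniform convergence; see
\<open>bcontfun_tendsto_if_along_points\<close>. Uniform continuity of \<open>h\<close> gives the pointwise convergence under
the Gaussian mean.\<close>

lemma heat_tendsto_uniform: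
  fixes h :: "real ^ 'n::finite \<Rightarrow> complex"
  assumes h: "uniformly_continuous_on UNIV h" "\<And>y. norm (h y) \<le> M"
    and \<tau>: "\<tau> \<longlonglongrightarrow> 0" "\<And>n. \<tau> n \<ge> 0"
  shows "(\<lambda>n. heat (\<tau> n) h (X n) - h (X n)) \<longlonglongrightarrow> 0"
proof -
  have c: "continuous_on UNIV h" using h(1) by (rule uniformly_continuous_imp_continuous)
  have [measurable]: "h \<in> borel_measurable borel"
    by (rule borel_measurable_continuous_onI[OF c])
  have eq: "heat (\<tau> n) h (X n) - h (X n)
      = (LINT z|gauss. h (X n - sqrt (\<tau> n) *\<^sub>R z) - h (X n))" for n
    using integrable_gauss[OF c h(2)]
    by (simp add: heat_eq_gauss[OF c \<tau>(2)] gauss.prob_space[unfolded space_gauss])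
  have "(\<lambda>n. LINT z|gauss. h (X n - sqrt (\<tau> n) *\<^sub>R z) - h (X n))
      \<longlonglongrightarrow> (LINT z|(gauss :: (real ^ 'n) measure). 0)"
  proof (rule integral_dominated_convergence[where w = "\<lambda>_. M + M"])
    show "AE z in gauss. (\<lambda>n. h (X n - sqrt (\<tau> n) *\<^sub>R z) - h (X n)) \<longlonglongrightarrow> 0"
    proof (rule AE_I2)
      fix z :: "real ^ 'n"
      have "(\<lambda>n. sqrt (\<tau> n) * norm z) \<longlonglongrightarrow> sqrt 0 * norm z" by (intro tendsto_intros \<tau>)
      then have "(\<lambda>n. dist (X n - sqrt (\<tau> n) *\<^sub>R z) (X n)) \<longlonglongrightarrow> 0"
        using \<tau>(2) by (simp add: dist_norm)
      then have "(\<lambda>n. dist (h (X n - sqrt (\<tau> n) *\<^sub>R z)) (h (X n))) \<longlonglongrightarrow> 0"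
        using h(1)[unfolded uniformly_continuous_on_sequentially, rule_format,
            of "\<lambda>n. X n - sqrt (\<tau> n) *\<^sub>R z" X] by simp
      then show "(\<lambda>n. h (X n - sqrt (\<tau> n) *\<^sub>R z) - h (X n)) \<longlonglongrightarrow> 0"
        by (simp add: dist_norm tendsto_norm_zero_iff)
    qed
    show "AE z in gauss. norm (h (X n - sqrt (\<tau> n) *\<^sub>R z) - h (X n)) \<le> M + M" for n
      using h(2) by (intro AE_I2 order_trans[OF norm_triangle_ineq4] add_mono) auto
  qed auto
  then show ?thesis unfolding eq by simp
qed

section \<open>The Duhamel integral\<close>

definition duhamel_int ::
  "(real \<times> (real ^ 'n::finite) \<Rightarrow> complex) \<Rightarrow> real \<Rightarrow> real ^ 'n \<Rightarrow> complex" where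
  "duhamel_int H t x = (LINT s:{0..t}|lborel. heat (t - s) (\<lambda>y. H (s, y)) x)"

lemma continuous_slice:
  "continuous_on UNIV H \<Longrightarrow> continuous_on UNIV (\<lambda>y. H (s, y))"
  by (rule continuous_on_compose2[where g = H]) (auto intro!: continuous_intros)

lemma set_integrable_duhamel:
  assumes H: "continuous_on UNIV H" "\<And>p. norm (H p) \<le> M" and "b \<le> t"
  shows "set_integrable lborel {a..b} (\<lambda>s. heat (t - s) (\<lambda>y. H (s, y)) x)"
proof (rule borel_integrable_atLeastAtMost')
  show "continuous_on {a..b} (\<lambda>s. heat (t - s) (\<lambda>y. H (s, y)) x)"
    unfolding continuous_on_sequentially o_def
  proof safe
    fix \<sigma> s assume \<sigma>: "\<forall>n. \<sigma> n \<in> {a..b}" "\<sigma> \<longlonglongrightarrow> s"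
    have "\<sigma> n \<le> t" for n using \<sigma>(1)[rule_format, of n] \<open>b \<le> t\<close> by simp
    then show "(\<lambda>n. heat (t - \<sigma> n) (\<lambda>y. H (\<sigma> n, y)) x) \<longlonglongrightarrow> heat (t - s) (\<lambda>y. H (s, y)) x"
      by (intro heat_tendsto[OF H] tendsto_intros \<sigma>(2)) simp
  qed
qed

lemma norm_set_integral_le:
  fixes f :: "real \<Rightarrow> complex"
  assumes "set_integrable lborel A f" "set_integrable lborel A b" "\<And>s. s \<in> A \<Longrightarrow> norm (f s) \<le> b s"
  shows "norm (LINT s:A|lborel. f s) \<le> (LINT s:A|lborel. b s)"
proof -
  have "norm (LINT s:A|lborel. f s) \<le> (LINT s|lborel. norm (indicator A s *\<^sub>R f s))"
    unfolding set_lebesgue_integral_def by (rule integral_norm_bound)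
  also have "\<dots> \<le> (LINT s:A|lborel. b s)"
    unfolding set_lebesgue_integral_def
  proof (rule integral_mono)
    show "indicator A s *\<^sub>R b s \<ge> norm (indicator A s *\<^sub>R f s)" for s
      using assms(3) by (simp add: indicator_def)
  qed (use assms in \<open>auto simp only: set_integrable_def intro!: integrable_norm\<close>)
  finally show ?thesis .
qed

lemma norm_duhamel_int_diff_le:
  assumes H: "continuous_on UNIV H" "\<And>p. norm (H p) \<le> M"
    and H': "continuous_on UNIV H'" "\<And>p. norm (H' p) \<le> M'"
    and b: "continuous_on {0..t} b" "\<And>s y. s \<in> {0..t} \<Longrightarrow> norm (H (s, y) - H' (s, y)) \<le> b s"
  shows "norm (duhamel_int H t x - duhamel_int H' t x) \<le> (LINT s:{0..t}|lborel. b s)"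
  unfolding duhamel_int_def
    set_integral_diff(2)[OF set_integrable_duhamel[OF H order_refl] set_integrable_duhamel[OF H' order_refl], symmetric]
proof (rule norm_set_integral_le)
  show "set_integrable lborel {0..t} b" by (rule borel_integrable_atLeastAtMost'[OF b(1)])
  show "norm (heat (t - s) (\<lambda>y. H (s, y)) x - heat (t - s) (\<lambda>y. H' (s, y)) x) \<le> b s"
    if "s \<in> {0..t}" for s
    using that b(2)[OF that] H(2) H'(2)
    by (intro norm_heat_diff_le[OF continuous_slice[OF H(1)] _ continuous_slice[OF H'(1)]]) auto
qed (intro set_integral_diff(1) set_integrable_duhamel[OF H] set_integrable_duhamel[OF H'] order_refl)

lemma integrable_indicator_Icc [simp]: "integrable lborel (indicat_real {a..b :: real})"
  by (rule integrable_real_indicator) (auto simp: emeasure_lborel_Icc_eq)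

lemma set_integral_const_Icc: "a \<le> b \<Longrightarrow> (LINT s:{a..b}|lborel. (c::real)) = (b - a) * c"
  by (simp add: set_lebesgue_integral_def)

lemma norm_duhamel_int_le:
  assumes H: "continuous_on UNIV H" "\<And>p. norm (H p) \<le> M" and "t \<ge> 0"
  shows "norm (duhamel_int H t x) \<le> t * M"
proof -
  have "heat r (\<lambda>_. 0) x = 0" for r by (simp add: heat_def)
  then have "duhamel_int (\<lambda>_. 0) t x = 0" by (simp add: duhamel_int_def set_lebesgue_integral_def)
  then show ?thesis
    using norm_duhamel_int_diff_le[OF H, of "\<lambda>_. 0" 0 t "\<lambda>_. M" x] H(2) assms(3)
    by (simp add: set_integral_const_Icc)
qed

text \<open>A modulus of continuity in time, per unit of the supremum of the source, of the Duhamel integral on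
\<open>[0, T]\<close>; \<open>p\<close> is half the space dimension.\<close>

definition duhamel_modulus :: "real \<Rightarrow> real \<Rightarrow> real \<Rightarrow> real" where
  "duhamel_modulus p T d = d + 2 * sqrt d + T * (2 * ((1 + sqrt d) powr p - 1))"

lemma continuous_on_duhamel_modulus: "continuous_on {0..} (duhamel_modulus p T)"
  unfolding duhamel_modulus_def[abs_def] by (intro continuous_intros) (auto simp: add_nonneg_eq_0_iff)

text \<open>With \<open>d = t - t\<^sub>0\<close>, the times \<open>s \<in> (t\<^sub>0, t]\<close> contribute at most \<open>M d\<close>. The kernels at the times
\<open>t - s\<close> and \<open>t\<^sub>0 - s\<close> are close in \<open>L\<^sup>1\<close> only if the ratio \<open>1 + d / (t\<^sub>0 - s)\<close> is close to \<open>1\<close>. The last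
\<open>e\<close> units of time before \<open>t\<^sub>0\<close> are therefore estimated by the trivial bound \<open>2 M\<close>, and before them
the ratio is at most \<open>1 + d / e\<close>. The choice \<open>e = sqrt d\<close> makes both \<open>e\<close> and \<open>d / e\<close> small.\<close>

lemma norm_duhamel_int_time_diff_le:
  fixes H :: "real \<times> (real ^ 'n::finite) \<Rightarrow> complex"
  assumes H: "continuous_on UNIV H" "\<And>p. norm (H p) \<le> M"
    and st: "0 \<le> t\<^sub>0" "t\<^sub>0 < t" "t \<le> T"
  shows "norm (duhamel_int H t x - duhamel_int H t\<^sub>0 x)
     \<le> M * duhamel_modulus (real CARD('n) / 2) T (t - t\<^sub>0)"
proof -
  define d where "d = t - t\<^sub>0"
  define e where "e = sqrt d"
  define w where "w = 2 * ((1 + e) powr (real CARD('n) / 2) - 1)"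
  let ?f = "\<lambda>r s. heat (r - s) (\<lambda>y. H (s, y)) x"
  let ?b = "\<lambda>s. (2 * M) * indicator {t\<^sub>0 - e..t\<^sub>0} s + M * w"
  have d: "d > 0" and e: "e > 0" and ee: "d / e = e" using st by (auto simp: d_def e_def real_div_sqrt)
  have M: "M \<ge> 0" using H(2) norm_ge_zero order_trans by blast
  have w: "w \<ge> 0" using e by (simp add: w_def ge_one_powr_ge_zero)
  have t: "t \<ge> 0" using st by simp
  note slice = continuous_slice[OF H(1)]
  have small: "norm (?f t s - ?f t\<^sub>0 s) \<le> ?b s" if s: "s \<in> {0..t\<^sub>0}" for s
  proof (cases "s \<ge> t\<^sub>0 - e")
    case True
    have "norm (?f t s) \<le> M" "norm (?f t\<^sub>0 s) \<le> M"
      using s st H(2) by (auto intro!: norm_heat_le slice)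
    then have "norm (?f t s - ?f t\<^sub>0 s) \<le> 2 * M" using norm_triangle_ineq4[of "?f t s" "?f t\<^sub>0 s"] by linarith
    moreover have "M * w \<ge> 0" using M w by simp
    ultimately show ?thesis using s True by simp
  next
    case False
    have "norm (?f t s - ?f t\<^sub>0 s)
        \<le> M * (2 * (((t - s) / (t\<^sub>0 - s)) powr (real CARD('n) / 2) - 1))"
      using False e st H(2) by (intro norm_heat_time_diff_le slice) auto
    also have "\<dots> \<le> M * w"
    proof -
      have "(t - s) / (t\<^sub>0 - s) = 1 + d / (t\<^sub>0 - s)" using False e by (simp add: d_def field_simps)
      also have "d / (t\<^sub>0 - s) \<le> d / e" using False d e by (intro divide_left_mono) auto
      finally have "(t - s) / (t\<^sub>0 - s) \<le> 1 + e" by (simp add: ee)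
      moreover have "(t - s) / (t\<^sub>0 - s) \<ge> 0" using False e st by simp
      ultimately show ?thesis
        unfolding w_def using M by (intro mult_left_mono diff_right_mono powr_mono2) auto
    qed
    finally show ?thesis using False by simp
  qed
  have ib: "integrable lborel (\<lambda>s. indicator {0..t\<^sub>0} s *\<^sub>R ?b s)"
  proof (rule Bochner_Integration.integrable_bound[where f = "\<lambda>s. indicator {0..t\<^sub>0} s * (2 * M + M * w)"])
    show "AE s in lborel. norm (indicator {0..t\<^sub>0} s *\<^sub>R ?b s) \<le> norm (indicator {0..t\<^sub>0} s * (2 * M + M * w))"
      using M w by (auto simp: indicator_def)
  qed auto
  have split: "duhamel_int H t x = (LINT s:{0..t\<^sub>0}|lborel. ?f t s) + (LINT s:{t\<^sub>0<..t}|lborel. ?f t s)"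
  proof -
    have un: "{0..t} = {0..t\<^sub>0} \<union> {t\<^sub>0<..t}" using st by auto
    show ?thesis unfolding duhamel_int_def un
      using st by (intro set_integral_Un set_integrable_subset[OF set_integrable_duhamel[OF H order_refl, of 0 t x]]) auto
  qed
  have 1: "norm ((LINT s:{0..t\<^sub>0}|lborel. ?f t s) - duhamel_int H t\<^sub>0 x) \<le> 2 * M * e + T * (M * w)"
  proof -
    have i1: "set_integrable lborel {0..t\<^sub>0} (?f t)" using st by (intro set_integrable_duhamel[OF H]) auto
    have i2: "set_integrable lborel {0..t\<^sub>0} (?f t\<^sub>0)" by (intro set_integrable_duhamel[OF H]) auto
    have "(LINT s:{0..t\<^sub>0}|lborel. ?f t s) - duhamel_int H t\<^sub>0 x = (LINT s:{0..t\<^sub>0}|lborel. ?f t s - ?f t\<^sub>0 s)"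
      unfolding duhamel_int_def using set_integral_diff(2)[OF i1 i2] by simp
    also have "norm \<dots> \<le> (LINT s:{0..t\<^sub>0}|lborel. ?b s)"
      using ib small by (intro norm_set_integral_le set_integral_diff i1 i2) (auto simp: set_integrable_def)
    also have "\<dots> \<le> (LINT s|lborel. (2 * M) * indicator {t\<^sub>0 - e..t\<^sub>0} s + (M * w) * indicator {0..t\<^sub>0} s)"
      unfolding set_lebesgue_integral_def
    proof (rule integral_mono[OF ib])
      show "integrable lborel (\<lambda>s. (2 * M) * indicator {t\<^sub>0 - e..t\<^sub>0} s + (M * w) * indicator {0..t\<^sub>0} s)"
        by (intro Bochner_Integration.integrable_add integrable_mult_right integrable_indicator_Icc)
      show "indicator {0..t\<^sub>0} s *\<^sub>R ?b s
          \<le> (2 * M) * indicator {t\<^sub>0 - e..t\<^sub>0} s + (M * w) * indicator {0..t\<^sub>0} s" for s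
        using M by (simp add: indicator_def)
    qed
    also have "\<dots> = 2 * M * e + t\<^sub>0 * (M * w)" using e st by simp
    also have "\<dots> \<le> 2 * M * e + T * (M * w)" using st M w by (intro add_left_mono mult_right_mono) auto
    finally show ?thesis .
  qed
  have 2: "norm (LINT s:{t\<^sub>0<..t}|lborel. ?f t s) \<le> d * M"
  proof -
    have "norm (LINT s:{t\<^sub>0<..t}|lborel. ?f t s) \<le> (LINT s:{t\<^sub>0<..t}|lborel. M)"
      using set_integrable_duhamel[OF H order_refl, of t\<^sub>0 t x] H(2) st
      by (intro norm_set_integral_le norm_heat_le slice)
         (auto simp: set_integrable_def intro: set_integrable_subset[unfolded set_integrable_def])
    also have "\<dots> = d * M" using st by (simp add: set_lebesgue_integral_def d_def)
    finally show ?thesis .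
  qed
  have "norm (duhamel_int H t x - duhamel_int H t\<^sub>0 x) \<le> 2 * M * e + T * (M * w) + d * M"
  proof -
    have "duhamel_int H t x - duhamel_int H t\<^sub>0 x
       = ((LINT s:{0..t\<^sub>0}|lborel. ?f t s) - duhamel_int H t\<^sub>0 x) + (LINT s:{t\<^sub>0<..t}|lborel. ?f t s)"
      using split by simp
    then show ?thesis by (simp only: norm_triangle_mono[OF 1 2])
  qed
  also have "\<dots> = M * duhamel_modulus (real CARD('n) / 2) T d"
    by (simp add: duhamel_modulus_def e_def w_def algebra_simps)
  finally show ?thesis by (simp add: d_def)
qed

lemma duhamel_int_tendsto_time:
  fixes H :: "real \<times> (real ^ 'n::finite) \<Rightarrow> complex"
  assumes H: "continuous_on UNIV H" "\<And>p. norm (H p) \<le> M"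
    and \<tau>: "\<tau> \<longlonglongrightarrow> t" "\<And>n. \<tau> n \<ge> 0"
  shows "(\<lambda>n. duhamel_int H (\<tau> n) (X n) - duhamel_int H t (X n)) \<longlonglongrightarrow> 0"
proof -
  have t: "t \<ge> 0" using LIMSEQ_le_const[OF \<tau>(1)] \<tau>(2) by blast
  obtain T where T: "\<And>n. \<bar>\<tau> n\<bar> \<le> T"
    using Bseq_eq_bounded convergent_imp_Bseq[of \<tau>] \<tau>(1)
    by (metis BseqE convergentI real_norm_def)
  have tT: "t \<le> T" by (rule LIMSEQ_le_const2[OF \<tau>(1)]) (use T abs_le_D1 in blast)
  let ?m = "duhamel_modulus (real CARD('n) / 2) T"
  have m0: "?m 0 = 0" by (simp add: duhamel_modulus_def)
  have "(\<lambda>n. \<bar>\<tau> n - t\<bar>) \<longlonglongrightarrow> 0"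
    using tendsto_rabs[OF tendsto_diff[OF \<tau>(1) tendsto_const[of t]]] by simp
  then have "(\<lambda>n. ?m \<bar>\<tau> n - t\<bar>) \<longlonglongrightarrow> ?m 0"
    by (rule continuous_on_tendsto_compose[OF continuous_on_duhamel_modulus]) auto
  then have lim: "(\<lambda>n. M * ?m \<bar>\<tau> n - t\<bar>) \<longlonglongrightarrow> 0"
    unfolding m0 by (rule tendsto_mult_right_zero)
  have "norm (duhamel_int H (\<tau> n) (X n) - duhamel_int H t (X n)) \<le> M * ?m \<bar>\<tau> n - t\<bar>" for n
  proof (cases "\<tau> n" t rule: linorder_cases)
    case less
    then show ?thesis
      using norm_duhamel_int_time_diff_le[OF H \<tau>(2) less tT, of "X n"]
      by (simp add: norm_minus_commute)
  next
    case greater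
    then show ?thesis
      using norm_duhamel_int_time_diff_le[OF H t greater, of T "X n"] T[of n] by auto
  qed (simp add: m0)
  then show ?thesis by (intro Lim_null_comparison[OF _ lim] always_eventually allI)
qed

lemma duhamel_int_tendsto_space:
  assumes H: "continuous_on UNIV H" "\<And>p. norm (H p) \<le> M" and X: "X \<longlonglongrightarrow> x"
  shows "(\<lambda>n. duhamel_int H t (X n)) \<longlonglongrightarrow> duhamel_int H t x"
  unfolding duhamel_int_def set_lebesgue_integral_def
proof (rule integral_dominated_convergence[where w = "\<lambda>s. indicator {0..t} s * M"])
  have "integrable lborel (\<lambda>s. indicator {0..t} s *\<^sub>R heat (t - s) (\<lambda>y. H (s, y)) z)" for z
    using set_integrable_duhamel[OF H order_refl, of 0 t z] by (simp add: set_integrable_def)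
  then show "(\<lambda>s. indicator {0..t} s *\<^sub>R heat (t - s) (\<lambda>y. H (s, y)) z) \<in> borel_measurable lborel" for z
    by (rule borel_measurable_integrable)
  then show "(\<lambda>s. indicator {0..t} s *\<^sub>R heat (t - s) (\<lambda>y. H (s, y)) z) \<in> borel_measurable lborel" for z .
  show "AE s in lborel. (\<lambda>n. indicator {0..t} s *\<^sub>R heat (t - s) (\<lambda>y. H (s, y)) (X n))
      \<longlonglongrightarrow> indicator {0..t} s *\<^sub>R heat (t - s) (\<lambda>y. H (s, y)) x"
    by (rule AE_I2) (auto simp: indicator_def intro!: heat_tendsto[OF H] X)
  show "AE s in lborel. norm (indicator {0..t} s *\<^sub>R heat (t - s) (\<lambda>y. H (s, y)) (X n))
      \<le> indicator {0..t} s * M" for n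
    by (rule AE_I2) (auto simp: indicator_def intro!: norm_heat_le continuous_slice H)
qed auto

lemma duhamel_int_tendsto:
  assumes H: "continuous_on UNIV H" "\<And>p. norm (H p) \<le> M"
    and \<tau>: "\<tau> \<longlonglongrightarrow> t" "\<And>n. \<tau> n \<ge> 0" and X: "X \<longlonglongrightarrow> x"
  shows "(\<lambda>n. duhamel_int H (\<tau> n) (X n)) \<longlonglongrightarrow> duhamel_int H t x"
  using tendsto_add[OF duhamel_int_tendsto_time[OF H \<tau>, of X] duhamel_int_tendsto_space[OF H X, of t]]
  by simp

section \<open>The norm of the solution space\<close>

lemma bounded_Re_Im_bcontfun:
  fixes f :: "'n::finite Y"
  shows "bdd_above (range (\<lambda>x. \<bar>Re (apply_bcontfun f x)\<bar>))"
    and "bdd_above (range (\<lambda>x. \<bar>Im (apply_bcontfun f x)\<bar>))"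
  by (auto intro!: bdd_aboveI[of _ "norm f"] order_trans[OF abs_Re_le_cmod norm_bounded]
      order_trans[OF abs_Im_le_cmod norm_bounded])

lemma Y_norm_le_norm: "Y_norm f \<le> norm f"
  unfolding Y_norm_def
  by (auto intro!: cSUP_least order_trans[OF abs_Re_le_cmod norm_bounded]
      order_trans[OF abs_Im_le_cmod norm_bounded])

text \<open>Together with \<open>Y_norm_le_norm\<close> this makes the norm of the solution space equivalent to the
supremum norm, so that the complete space of bounded continuous functions can be used throughout.\<close>

lemma norm_le_Y_norm: "norm f \<le> 2 * Y_norm f"
proof (rule norm_bound)
  fix x
  have "cmod (apply_bcontfun f x) \<le> \<bar>Re (apply_bcontfun f x)\<bar> + \<bar>Im (apply_bcontfun f x)\<bar>"
    by (rule cmod_le)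
  also have "\<dots> \<le> Y_norm f + Y_norm f"
    unfolding Y_norm_def
    by (intro add_mono max.coboundedI1[OF cSUP_upper] max.coboundedI2[OF cSUP_upper] bounded_Re_Im_bcontfun) auto
  finally show "cmod (apply_bcontfun f x) \<le> 2 * Y_norm f" by simp
qed

lemma Y_norm_nonneg: "Y_norm f \<ge> 0"
  using norm_le_Y_norm[of f] norm_ge_zero[of f] by linarith

lemma Y_norm_tendsto_iff: "((\<lambda>t. Y_norm (u t - l)) \<longlongrightarrow> 0) F \<longleftrightarrow> (u \<longlongrightarrow> l) F"
proof
  assume "((\<lambda>t. Y_norm (u t - l)) \<longlongrightarrow> 0) F"
  then have "((\<lambda>t. 2 * Y_norm (u t - l)) \<longlongrightarrow> 0) F" by (rule tendsto_mult_right_zero)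
  then have "((\<lambda>t. u t - l) \<longlongrightarrow> 0) F"
    by (rule Lim_null_comparison[rotated]) (intro always_eventually allI norm_le_Y_norm)
  then show "(u \<longlongrightarrow> l) F" by (rule LIM_zero_cancel)
next
  assume "(u \<longlongrightarrow> l) F"
  then have "((\<lambda>t. norm (u t - l)) \<longlongrightarrow> 0) F"
    using tendsto_norm_zero LIM_zero by blast
  then show "((\<lambda>t. Y_norm (u t - l)) \<longlongrightarrow> 0) F"
    by (rule Lim_null_comparison[rotated])
       (intro always_eventually allI, simp add: Y_norm_le_norm Y_norm_nonneg)
qed

lemma Y_continuous_on_iff: "Y_continuous_on I u \<longleftrightarrow> continuous_on I u"
  unfolding Y_continuous_on_def continuous_on_def Y_norm_tendsto_iff ..

text \<open>Choosing points where the supremum is almost attained turns uniform convergence into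
convergence along sequences of points, to which dominated convergence applies.\<close>

lemma bcontfun_tendsto_if_along_points:
  fixes u :: "nat \<Rightarrow> ('a::topological_space \<Rightarrow>\<^sub>C 'b::real_normed_vector)"
  assumes "\<And>X. (\<lambda>n. apply_bcontfun (u n) (X n) - apply_bcontfun l (X n)) \<longlonglongrightarrow> 0"
  shows "u \<longlonglongrightarrow> l"
proof -
  have "\<exists>x. norm (u n - l) \<le> norm (apply_bcontfun (u n) x - apply_bcontfun l x) + 1 / real (Suc n)" for n
  proof (rule ccontr)
    assume "\<not> ?thesis"
    then have "norm (apply_bcontfun (u n - l) x) \<le> norm (u n - l) - 1 / real (Suc n)" for x
      by (simp add: not_le less_imp_le le_diff_eq)
    then have "norm (u n - l) \<le> norm (u n - l) - 1 / real (Suc n)" by (rule norm_bound)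
    then show False by simp
  qed
  then obtain X where X: "\<And>n. norm (u n - l)
      \<le> norm (apply_bcontfun (u n) (X n) - apply_bcontfun l (X n)) + 1 / real (Suc n)"
    by metis
  have "(\<lambda>n. norm (apply_bcontfun (u n) (X n) - apply_bcontfun l (X n)) + 1 / real (Suc n)) \<longlonglongrightarrow> 0 + 0"
    by (intro tendsto_add tendsto_norm_zero assms LIMSEQ_Suc lim_1_over_n)
  then have lim: "(\<lambda>n. norm (apply_bcontfun (u n) (X n) - apply_bcontfun l (X n)) + 1 / real (Suc n)) \<longlonglongrightarrow> 0"
    by (simp only: add_0_right)
  have "(\<lambda>n. u n - l) \<longlonglongrightarrow> 0"
    by (rule Lim_null_comparison[OF always_eventually lim]) (use X in blast)
  then show ?thesis by (rule LIM_zero_cancel)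
qed

section \<open>Functions of time and space\<close>

text \<open>Clipping the time to \<open>[0, T]\<close> extends a function on \<open>[0, T]\<close> to all times, with the same bounds,
so that functions of time and space form a type of bounded continuous functions.\<close>

definition clip :: "real \<Rightarrow> real \<Rightarrow> real" where
  "clip T t = max 0 (min T t)"

lemma clip_bounds: "T \<ge> 0 \<Longrightarrow> 0 \<le> clip T t \<and> clip T t \<le> T"
  by (auto simp: clip_def)

lemma clip_ident: "0 \<le> t \<Longrightarrow> t \<le> T \<Longrightarrow> clip T t = t"
  by (auto simp: clip_def)

lemma clip_tendsto: "(f \<longlongrightarrow> l) F \<Longrightarrow> ((\<lambda>n. clip T (f n)) \<longlongrightarrow> clip T l) F"
  unfolding clip_def by (intro tendsto_max tendsto_min tendsto_const)

type_synonym 'n YT = "(real \<times> (real ^ 'n)) \<Rightarrow>\<^sub>C complex"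

lemma continuous_on_UNIV_prod_sequentiallyI:
  fixes f :: "'a::metric_space \<times> 'b::metric_space \<Rightarrow> 'c::metric_space"
  assumes "\<And>\<sigma> s X x. \<sigma> \<longlonglongrightarrow> s \<Longrightarrow> X \<longlonglongrightarrow> x \<Longrightarrow> (\<lambda>n. f (\<sigma> n, X n)) \<longlonglongrightarrow> f (s, x)"
  shows "continuous_on UNIV f"
  unfolding continuous_on_sequentially o_def
proof safe
  fix P and s x assume P: "P \<longlonglongrightarrow> (s :: 'a, x :: 'b)"
  from assms[OF tendsto_fst[OF P, simplified] tendsto_snd[OF P, simplified]]
  show "(\<lambda>n. f (P n)) \<longlonglongrightarrow> f (s, x)" by simp
qed

definition time_slice :: "'n::finite YT \<Rightarrow> real \<Rightarrow> 'n Y" where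
  "time_slice U t = Bcontfun (\<lambda>x. apply_bcontfun U (t, x))"

lemma apply_time_slice [simp]:
  "apply_bcontfun (time_slice U t) x = apply_bcontfun U (t, x)"
proof -
  have "(\<lambda>x. apply_bcontfun U (t, x)) \<in> bcontfun"
    by (rule bcontfun_normI[where b = "norm U"]) (auto intro: continuous_slice norm_bounded)
  then show ?thesis by (simp add: time_slice_def Bcontfun_inverse)
qed

lemma norm_time_slice_diff_le: "norm (time_slice U t - time_slice V t) \<le> dist U V"
  by (rule norm_bound) (simp add: dist_norm[symmetric] dist_bounded)

section \<open>Mild solutions of an equation with Lipschitz nonlinearity\<close>

definition mild_solution ::
  "real \<Rightarrow> real \<Rightarrow> (complex \<Rightarrow> complex) \<Rightarrow> 'n::finite Y \<Rightarrow> 'n YT \<Rightarrow> bool" where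
  "mild_solution T lam F h U \<longleftrightarrow> (\<forall>t x. apply_bcontfun U (t, x) =
      heat (clip T t) (apply_bcontfun h) x
      + complex_of_real lam * duhamel_int (\<lambda>p. F (apply_bcontfun U p)) (clip T t) x)"

lemma continuous_on_comp_bcontfun:
  "continuous_on UNIV F \<Longrightarrow> continuous_on UNIV (\<lambda>p. F (apply_bcontfun U p))"
  by (rule continuous_on_compose2[where g = F]) auto

lemma norm_bcontfun_diff_le: "norm (apply_bcontfun U p - apply_bcontfun V p) \<le> dist U V"
  by (simp add: dist_norm[symmetric] dist_bounded)

lemma duhamel_int_contraction:
  fixes U V :: "'n::finite YT"
  assumes F: "continuous_on UNIV F" "\<And>z. norm (F z) \<le> M"
    and L: "\<And>z w. norm (F z - F w) \<le> L * norm (z - w)" "L \<ge> 0" and lam: "\<bar>lam\<bar> \<le> 1" and t: "0 \<le> t" "t \<le> T"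
  shows "norm (complex_of_real lam * duhamel_int (\<lambda>p. F (apply_bcontfun U p)) t x
      - complex_of_real lam * duhamel_int (\<lambda>p. F (apply_bcontfun V p)) t x) \<le> T * L * dist U V"
proof -
  have "norm (duhamel_int (\<lambda>p. F (apply_bcontfun U p)) t x - duhamel_int (\<lambda>p. F (apply_bcontfun V p)) t x)
      \<le> (LINT s:{0..t}|lborel. L * dist U V)"
  proof (rule norm_duhamel_int_diff_le)
    show "norm (F (apply_bcontfun U (s, y)) - F (apply_bcontfun V (s, y))) \<le> L * dist U V" for s y
      using L(1) mult_left_mono[OF norm_bcontfun_diff_le L(2)] by (rule order_trans)
  qed (use F in \<open>auto intro: continuous_on_comp_bcontfun\<close>)
  also have "\<dots> = t * (L * dist U V)" using t by (simp add: set_integral_const_Icc)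
  also have "\<dots> \<le> T * (L * dist U V)" using t L(2) by (intro mult_right_mono) auto
  finally have *: "norm (duhamel_int (\<lambda>p. F (apply_bcontfun U p)) t x
      - duhamel_int (\<lambda>p. F (apply_bcontfun V p)) t x) \<le> T * L * dist U V"
    by (simp add: mult.assoc)
  show ?thesis
    unfolding right_diff_distrib[symmetric] norm_mult norm_of_real
    using mult_mono[OF lam *] by simp
qed

text \<open>The right-hand side of the mild equation maps the bounded continuous functions of time and space
to themselves and is a contraction with factor \<open>T * L\<close>.\<close>

lemma mild_solution_exists:
  fixes h :: "'n::finite Y"
  assumes F: "continuous_on UNIV F" "\<And>z. norm (F z) \<le> M"
    and L: "\<And>z w. norm (F z - F w) \<le> L * norm (z - w)" "L \<ge> 0"
    and lam: "\<bar>lam\<bar> \<le> 1" and T: "T \<ge> 0" "T * L < 1"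
  obtains U where "mild_solution T lam F h U"
proof -
  define \<Phi> where "\<Phi> U = (\<lambda>(t, x). heat (clip T t) (apply_bcontfun h) x
      + complex_of_real lam * duhamel_int (\<lambda>p. F (apply_bcontfun U p)) (clip T t) x)" for U :: "'n YT"
  have h: "continuous_on UNIV (apply_bcontfun h)" "\<And>y. norm (apply_bcontfun h y) \<le> norm h"
    by (auto intro: norm_bounded)
  note FU = continuous_on_comp_bcontfun[OF F(1)]
  have "\<Phi> U \<in> bcontfun" for U
  proof (rule bcontfun_normI)
    show "continuous_on UNIV (\<Phi> U)"
    proof (rule continuous_on_UNIV_prod_sequentiallyI)
      fix \<sigma> :: "nat \<Rightarrow> real" and s and X :: "nat \<Rightarrow> real ^ 'n" and x
      assume lim: "\<sigma> \<longlonglongrightarrow> s" "X \<longlonglongrightarrow> x"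
      have h2: "continuous_on UNIV (\<lambda>p :: real \<times> (real ^ 'n). apply_bcontfun h (snd p))"
        by (rule continuous_on_compose2[where g = "apply_bcontfun h"]) (auto intro!: continuous_intros)
      have "(\<lambda>n. heat (clip T (\<sigma> n)) (apply_bcontfun h) (X n)) \<longlonglongrightarrow> heat (clip T s) (apply_bcontfun h) x"
        using heat_tendsto[OF h2 h(2) lim(1) clip_tendsto[OF lim(1)] lim(2)] clip_bounds[OF T(1)] by simp
      then show "(\<lambda>n. \<Phi> U (\<sigma> n, X n)) \<longlonglongrightarrow> \<Phi> U (s, x)"
        unfolding \<Phi>_def prod.case using clip_bounds[OF T(1)]
        by (intro tendsto_intros duhamel_int_tendsto[OF FU F(2)] clip_tendsto lim) auto
    qed
    show "norm (\<Phi> U p) \<le> norm h + 1 * (T * M)" for p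
    proof (cases p)
      case (Pair t x)
      have c: "0 \<le> clip T t" "clip T t \<le> T" using clip_bounds[OF T(1)] by auto
      have M: "M \<ge> 0" using F(2) norm_ge_zero order_trans by blast
      have "norm (duhamel_int (\<lambda>p. F (apply_bcontfun U p)) (clip T t) x) \<le> clip T t * M"
        by (rule norm_duhamel_int_le[OF FU F(2) c(1)])
      also have "\<dots> \<le> T * M" using c M by (intro mult_right_mono)
      finally have "norm (complex_of_real lam * duhamel_int (\<lambda>p. F (apply_bcontfun U p)) (clip T t) x)
          \<le> 1 * (T * M)"
        unfolding norm_mult norm_of_real using lam by (intro mult_mono) auto
      then show ?thesis
        unfolding Pair \<Phi>_def prod.case by (intro norm_triangle_mono norm_heat_le[OF h c(1)])
    qed
  qed
  then have app: "apply_bcontfun (Bcontfun (\<Phi> U)) = \<Phi> U" for U by (rule Bcontfun_inverse)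
  have "\<exists>!U. Bcontfun (\<Phi> U) = U"
  proof (rule banach_fix_type)
    show "\<forall>U V. dist (Bcontfun (\<Phi> U)) (Bcontfun (\<Phi> V)) \<le> (T * L) * dist U V"
    proof (intro allI dist_bound)
      fix U V :: "'n YT" and p :: "real \<times> (real ^ 'n)"
      have "norm (\<Phi> U p - \<Phi> V p) \<le> T * L * dist U V"
        using duhamel_int_contraction[OF F L lam, of "clip T (fst p)" T U "snd p" V] clip_bounds[OF T(1)]
        by (simp add: \<Phi>_def split_beta)
      then show "dist (apply_bcontfun (Bcontfun (\<Phi> U)) p) (apply_bcontfun (Bcontfun (\<Phi> V)) p)
          \<le> T * L * dist U V"
        by (simp add: app dist_norm)
    qed
  qed (use T L in auto)
  then obtain U where "Bcontfun (\<Phi> U) = U" by blast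
  with app[of U] have fixp: "apply_bcontfun U = \<Phi> U" by simp
  have "mild_solution T lam F h U"
    unfolding mild_solution_def
    by (intro allI) (rule fun_cong[OF fixp, of "(_, _)", unfolded \<Phi>_def prod.case])
  then show thesis by (rule that)
qed

text \<open>Subtracting the two equations gives \<open>dist U V \<le> norm (h - k) + dist U V / 2\<close>.\<close>

lemma mild_solution_dependence:
  fixes h k :: "'n::finite Y"
  assumes F: "continuous_on UNIV F" "\<And>z. norm (F z) \<le> M"
    and L: "\<And>z w. norm (F z - F w) \<le> L * norm (z - w)" "L \<ge> 0"
    and lam: "\<bar>lam\<bar> \<le> 1" and T: "T \<ge> 0" "T * L \<le> 1 / 2"
    and U: "mild_solution T lam F h U" and V: "mild_solution T lam F k V"
  shows "dist U V \<le> 2 * norm (h - k)"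
proof -
  have "dist U V \<le> norm (h - k) + T * L * dist U V"
  proof (rule dist_bound)
    fix p :: "real \<times> (real ^ 'n)"
    obtain t x where p: "p = (t, x)" by (cases p)
    have c: "0 \<le> clip T t" "clip T t \<le> T" using clip_bounds[OF T(1)] by auto
    have "norm (apply_bcontfun h y - apply_bcontfun k y) \<le> norm (h - k)" for y
      using norm_bounded[of "h - k" y] by simp
    then have "norm (heat (clip T t) (apply_bcontfun h) x - heat (clip T t) (apply_bcontfun k) x) \<le> norm (h - k)"
      using c by (intro norm_heat_diff_le[where M = "norm h" and N = "norm k"]) (auto intro: norm_bounded)
    from norm_triangle_mono[OF this duhamel_int_contraction[OF F L lam c, of U x V]]
    show "dist (apply_bcontfun U p) (apply_bcontfun V p) \<le> norm (h - k) + T * L * dist U V"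
      using U V unfolding mild_solution_def p dist_norm by (simp add: algebra_simps)
  qed
  also have "T * L * dist U V \<le> 1 / 2 * dist U V" using T by (intro mult_right_mono) auto
  finally show ?thesis by simp
qed

lemma norm_mild_solution_le:
  fixes h :: "'n::finite Y"
  assumes F: "continuous_on UNIV F" "\<And>z. norm (F z) \<le> M"
    and lam: "\<bar>lam\<bar> \<le> 1" and T: "T \<ge> 0"
    and U: "mild_solution T lam F h U"
  shows "norm U \<le> norm h + T * M"
proof (rule norm_bound)
  fix p :: "real \<times> (real ^ 'n)"
  obtain t x where p: "p = (t, x)" by (cases p)
  have c: "0 \<le> clip T t" "clip T t \<le> T" using clip_bounds[OF T(1)] by auto
  have M: "M \<ge> 0" using F(2) norm_ge_zero order_trans by blast
  have "norm (duhamel_int (\<lambda>p. F (apply_bcontfun U p)) (clip T t) x) \<le> clip T t * M"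
    by (rule norm_duhamel_int_le[OF continuous_on_comp_bcontfun[OF F(1)] F(2) c(1)])
  also have "\<dots> \<le> T * M" using c M by (intro mult_right_mono)
  finally have "norm (complex_of_real lam * duhamel_int (\<lambda>p. F (apply_bcontfun U p)) (clip T t) x)
      \<le> 1 * (T * M)"
    unfolding norm_mult norm_of_real using lam by (intro mult_mono) auto
  moreover have "norm (heat (clip T t) (apply_bcontfun h) x) \<le> norm h"
    using c by (intro norm_heat_le) (auto intro: norm_bounded)
  ultimately show "norm (apply_bcontfun U p) \<le> norm h + T * M"
    using U unfolding mild_solution_def p by (metis norm_triangle_mono mult_1)
qed

lemma entire_lipschitz_on_cball:
  assumes F: "F holomorphic_on UNIV"
  obtains L where "L > 0" "\<And>z w. z \<in> cball 0 R \<Longrightarrow> w \<in> cball 0 R \<Longrightarrow> norm (F z - F w) \<le> L * norm (z - w)"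
proof -
  have "continuous_on (cball 0 R) (deriv F)"
    using holomorphic_deriv[OF F] by (intro holomorphic_on_imp_continuous_on) (auto intro: holomorphic_on_subset)
  then have "compact (deriv F ` cball 0 R)" by (intro compact_continuous_image) auto
  from compact_imp_bounded[OF this]
  obtain B where B: "\<And>z. z \<in> cball 0 R \<Longrightarrow> norm (deriv F z) \<le> B" unfolding bounded_iff by fast
  have "norm (F z - F w) \<le> max B 1 * norm (z - w)" if "z \<in> cball 0 R" "w \<in> cball 0 R" for z w
  proof (rule field_differentiable_bound[OF convex_cball _ _ that(1,2)])
    fix y :: complex assume y: "y \<in> cball 0 R"
    show "(F has_field_derivative deriv F y) (at y within cball 0 R)"
      using F by (intro DERIV_subset[OF holomorphic_derivI[OF F]]) auto
    show "norm (deriv F y) \<le> max B 1" using B[OF y] by simp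
  qed
  then show thesis by (intro that[of "max B 1"]) auto
qed

section \<open>Uniqueness for entire nonlinearities\<close>

lemma integral_exp_Icc:
  assumes "c > 0" "t \<ge> (0::real)"
  shows "(LINT s:{0..t}|lborel. exp (c * s)) = (exp (c * t) - 1) / c"
proof -
  have "(LINT s|lborel. indicator {0..t} s *\<^sub>R exp (c * s)) = exp (c * t) / c - exp (c * 0) / c"
  proof (rule integral_FTC_atLeastAtMost[OF assms(2)])
    show "((\<lambda>s. exp (c * s) / c) has_vector_derivative exp (c * s)) (at s within {0..t})" for s
      unfolding has_real_derivative_iff_has_vector_derivative[symmetric]
      using assms(1) by (auto intro!: derivative_eq_intros)
  qed (auto intro!: continuous_intros)
  then show ?thesis by (simp add: set_lebesgue_integral_def diff_divide_distrib)
qed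

text \<open>Gronwall's argument without a measurable majorant: if the difference at time \<open>s\<close> is at most
\<open>C exp (2 L s)\<close>, then Duhamel's formula bounds it at time \<open>t\<close> by
\<open>L C \<integral>\<^sub>0\<^sup>t exp (2 L s) ds \<le> (C / 2) exp (2 L t)\<close>, and the constant halves with each iteration.\<close>

lemma duhamel_equation_unique:
  fixes U V :: "'n::finite YT"
  assumes F: "continuous_on UNIV F"
    and L: "\<And>z w. z \<in> cball 0 R \<Longrightarrow> w \<in> cball 0 R \<Longrightarrow> norm (F z - F w) \<le> L * norm (z - w)" "L > 0"
    and R: "norm U \<le> R" "norm V \<le> R" and lam: "\<bar>lam\<bar> \<le> 1"
    and U: "\<And>t x. t \<in> {0..T} \<Longrightarrow> apply_bcontfun U (t, x) =
        f t x + complex_of_real lam * duhamel_int (\<lambda>p. F (apply_bcontfun U p)) t x"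
    and V: "\<And>t x. t \<in> {0..T} \<Longrightarrow> apply_bcontfun V (t, x) =
        f t x + complex_of_real lam * duhamel_int (\<lambda>p. F (apply_bcontfun V p)) t x"
    and t: "t \<in> {0..T}"
  shows "apply_bcontfun U (t, x) = apply_bcontfun V (t, x)"
proof -
  have inR: "apply_bcontfun U p \<in> cball 0 R" "apply_bcontfun V p \<in> cball 0 R" for p
    using R norm_bounded[of U p] norm_bounded[of V p] by auto
  have "compact (F ` cball 0 R)"
    by (intro compact_continuous_image continuous_on_subset[OF F]) auto
  from compact_imp_bounded[OF this]
  obtain M where M: "\<And>z. z \<in> cball 0 R \<Longrightarrow> norm (F z) \<le> M" unfolding bounded_iff by fast
  have bound: "norm (apply_bcontfun U (t, x) - apply_bcontfun V (t, x)) \<le> 2 * R * (1 / 2) ^ n * exp (2 * L * t)"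
    if "t \<in> {0..T}" for n t x
    using that
  proof (induction n arbitrary: t x)
    case 0
    have "norm (apply_bcontfun U (t, x) - apply_bcontfun V (t, x)) \<le> R + R"
      using inR[of "(t, x)"] by (intro order_trans[OF norm_triangle_ineq4] add_mono) auto
    also have "\<dots> \<le> 2 * R * exp (2 * L * t)"
      using 0 L(2) order_trans[OF norm_ge_zero R(1)] by (simp add: mult_le_cancel_left1)
    finally show ?case by simp
  next
    case (Suc n)
    let ?b = "\<lambda>s. L * (2 * R * (1 / 2) ^ n) * exp (2 * L * s)"
    have "norm (duhamel_int (\<lambda>p. F (apply_bcontfun U p)) t x - duhamel_int (\<lambda>p. F (apply_bcontfun V p)) t x)
        \<le> (LINT s:{0..t}|lborel. ?b s)"
    proof (rule norm_duhamel_int_diff_le[where M = M and M' = M])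
      fix s y assume "s \<in> {0..t}"
      then have s: "s \<in> {0..T}" using Suc.prems by auto
      have "norm (F (apply_bcontfun U (s, y)) - F (apply_bcontfun V (s, y)))
          \<le> L * norm (apply_bcontfun U (s, y) - apply_bcontfun V (s, y))"
        by (intro L inR)
      also have "\<dots> \<le> L * (2 * R * (1 / 2) ^ n * exp (2 * L * s))"
        using L(2) by (intro mult_left_mono Suc.IH s) auto
      finally show "norm (F (apply_bcontfun U (s, y)) - F (apply_bcontfun V (s, y))) \<le> ?b s"
        by (simp only: mult.assoc)
    qed (use F M inR in \<open>auto intro!: continuous_on_comp_bcontfun continuous_intros\<close>)
    also have "\<dots> = L * (2 * R * (1 / 2) ^ n) * ((exp (2 * L * t) - 1) / (2 * L))"
    proof -
      have "2 * L > 0" "t \<ge> 0" using L(2) Suc.prems by auto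
      then show ?thesis by (simp only: set_integral_mult_right integral_exp_Icc)
    qed
    also have "\<dots> = 2 * R * (1 / 2) ^ Suc n * (exp (2 * L * t) - 1)"
      using L(2) by (simp add: field_simps)
    also have "\<dots> \<le> 2 * R * (1 / 2) ^ Suc n * exp (2 * L * t)"
      using order_trans[OF norm_ge_zero R(1)] by (intro mult_left_mono) auto
    finally have "\<bar>lam\<bar> * norm (duhamel_int (\<lambda>p. F (apply_bcontfun U p)) t x
        - duhamel_int (\<lambda>p. F (apply_bcontfun V p)) t x) \<le> 1 * (2 * R * (1 / 2) ^ Suc n * exp (2 * L * t))"
      using lam by (intro mult_mono) auto
    moreover have "apply_bcontfun U (t, x) - apply_bcontfun V (t, x)
        = complex_of_real lam * (duhamel_int (\<lambda>p. F (apply_bcontfun U p)) t x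
            - duhamel_int (\<lambda>p. F (apply_bcontfun V p)) t x)"
      unfolding U[OF Suc.prems] V[OF Suc.prems] by (simp add: right_diff_distrib)
    ultimately show ?case by (simp add: norm_mult)
  qed
  have "(\<lambda>n. 2 * R * (1 / 2) ^ n * exp (2 * L * t)) \<longlonglongrightarrow> 2 * R * 0 * exp (2 * L * t)"
    by (intro tendsto_intros LIMSEQ_power_zero) auto
  then have lim: "(\<lambda>n. 2 * R * (1 / 2) ^ n * exp (2 * L * t)) \<longlonglongrightarrow> 0"
    by (simp only: mult_zero_right mult_zero_left)
  have "norm (apply_bcontfun U (t, x) - apply_bcontfun V (t, x)) \<le> 0"
    by (rule LIMSEQ_le_const[OF lim]) (use bound[OF t] in blast)
  then show ?thesis by simp
qed

section \<open>Solutions in the solution class\<close>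

text \<open>Solutions of the class are jointly continuous in time and space: at time \<open>0\<close> because the points
\<open>X n\<close> and their limit form a compact set, on which convergence is uniform, and at later times by
norm continuity.\<close>

lemma solution_class_tendsto:
  fixes v :: "real \<Rightarrow> 'n::finite Y"
  assumes v: "v \<in> solution_class T"
    and \<sigma>: "\<And>n. \<sigma> n \<in> {0..<T}" "s \<in> {0..<T}" "\<sigma> \<longlonglongrightarrow> s" and X: "X \<longlonglongrightarrow> x"
  shows "(\<lambda>n. apply_bcontfun (v (\<sigma> n)) (X n)) \<longlonglongrightarrow> apply_bcontfun (v s) x"
proof -
  have "(\<lambda>n. apply_bcontfun (v (\<sigma> n)) (X n) - apply_bcontfun (v s) (X n)) \<longlonglongrightarrow> 0"
  proof (cases "s = 0")
    case True
    define K where "K = insert x (range X)"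
    have K: "compact K" unfolding K_def by (rule compact_sequence_with_limit[OF X])
    have ul: "uniform_limit K (\<lambda>t. apply_bcontfun (v t)) (apply_bcontfun (v 0)) (at 0 within {0..<T})"
      using v K by (simp add: solution_class_def)
    show ?thesis
    proof (rule tendstoI)
      fix e :: real assume e: "e > 0"
      obtain d where d: "d > 0" "\<And>t x. t \<in> {0..<T} \<Longrightarrow> t \<noteq> 0 \<Longrightarrow> dist t 0 < d \<Longrightarrow> x \<in> K \<Longrightarrow>
          dist (apply_bcontfun (v t) x) (apply_bcontfun (v 0) x) < e"
        using uniform_limitD[OF ul e] unfolding eventually_at by blast
      have "\<forall>\<^sub>F n in sequentially. dist (\<sigma> n) s < d" using tendstoD[OF \<sigma>(3) d(1)] .
      then show "\<forall>\<^sub>F n in sequentially. dist (apply_bcontfun (v (\<sigma> n)) (X n) - apply_bcontfun (v s) (X n)) 0 < e"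
      proof eventually_elim
        case (elim n)
        then show ?case
          using d(2)[OF \<sigma>(1)[of n], of "X n"] True e
          by (cases "\<sigma> n = 0") (auto simp: K_def dist_norm)
      qed
    qed
  next
    case False
    with \<sigma>(2) have s: "s \<in> {0<..<T}" by auto
    have c: "continuous_on {0<..<T} v"
      using v by (simp add: solution_class_def Y_continuous_on_iff)
    have "\<forall>\<^sub>F n in sequentially. \<sigma> n > 0"
      using order_tendstoD(1)[OF \<sigma>(3), of 0] s by simp
    then have "\<forall>\<^sub>F n in sequentially. \<sigma> n \<in> {0<..<T}"
      by eventually_elim (use \<sigma>(1) in auto)
    then have "(\<lambda>n. v (\<sigma> n)) \<longlonglongrightarrow> v s"
      by (rule continuous_on_tendsto_compose[OF c \<sigma>(3) s])
    then have "(\<lambda>n. dist (v (\<sigma> n)) (v s)) \<longlonglongrightarrow> 0" by (rule tendsto_dist_iff[THEN iffD1])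
    then show ?thesis
      by (rule Lim_null_comparison[rotated])
         (intro always_eventually allI norm_bcontfun_diff_le)
  qed
  moreover have "(\<lambda>n. apply_bcontfun (v s) (X n)) \<longlonglongrightarrow> apply_bcontfun (v s) x"
    by (rule continuous_on_tendsto_compose[OF continuous_on_apply_bcontfun[of UNIV] X]) auto
  ultimately show ?thesis using tendsto_add by fastforce
qed

lemma solution_class_clip:
  fixes v :: "real \<Rightarrow> 'n::finite Y"
  assumes v: "v \<in> solution_class T" and T': "T' \<in> {0<..<T}"
  obtains V :: "'n YT" where "\<And>t x. apply_bcontfun V (t, x) = apply_bcontfun (v (clip T' t)) x"
proof -
  obtain B where B: "\<And>t. t \<in> {0..T'} \<Longrightarrow> Y_norm (v t) \<le> B"
    using v T' unfolding solution_class_def mem_Collect_eq by metis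
  have c: "clip T' t \<in> {0..T'}" "clip T' t \<in> {0..<T}" for t
    using clip_bounds[of T' t] T' by auto
  have "(\<lambda>(t, x). apply_bcontfun (v (clip T' t)) x) \<in> bcontfun"
  proof (rule bcontfun_normI)
    show "continuous_on UNIV (\<lambda>(t, x). apply_bcontfun (v (clip T' t)) x)"
      by (rule continuous_on_UNIV_prod_sequentiallyI)
         (simp only: prod.case, intro solution_class_tendsto[OF v] c clip_tendsto)
    show "norm (case p of (t, x) \<Rightarrow> apply_bcontfun (v (clip T' t)) x) \<le> 2 * B" for p
    proof (cases p)
      case (Pair t x)
      have "norm (apply_bcontfun (v (clip T' t)) x) \<le> norm (v (clip T' t))" by (rule norm_bounded)
      also have "\<dots> \<le> 2 * Y_norm (v (clip T' t))" by (rule norm_le_Y_norm)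
      also have "\<dots> \<le> 2 * B" using B[OF c(1)] by simp
      finally show ?thesis by (simp add: Pair)
    qed
  qed
  then have "apply_bcontfun (Bcontfun (\<lambda>(t, x). apply_bcontfun (v (clip T' t)) x)) (t, x)
      = apply_bcontfun (v (clip T' t)) x" for t x
    by (simp add: Bcontfun_inverse)
  then show thesis by (rule that)
qed

lemma duhamel_solution_iff_slices:
  assumes "\<And>s y. s \<in> {0..<T} \<Longrightarrow> apply_bcontfun (u s) y = apply_bcontfun U (s, y)"
  shows "duhamel_solution T lam F h u \<longleftrightarrow> (\<forall>t\<in>{0..<T}. \<forall>x. apply_bcontfun U (t, x) =
      heat t (apply_bcontfun h) x + complex_of_real lam * duhamel_int (\<lambda>p. F (apply_bcontfun U p)) t x)"
proof -
  have "(LINT s:{0..t}|lborel. heat (t - s) (\<lambda>y. F (apply_bcontfun (u s) y)) x)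
      = duhamel_int (\<lambda>p. F (apply_bcontfun U p)) t x" if "t \<in> {0..<T}" for t x
    unfolding duhamel_int_def using that assms
    by (intro set_lebesgue_integral_cong) auto
  then show ?thesis unfolding duhamel_solution_def using assms by simp
qed

lemma duhamel_solution_unique:
  fixes h :: "'n::finite Y"
  assumes F: "F holomorphic_on UNIV" and lam: "\<bar>lam\<bar> \<le> 1"
    and u: "u \<in> solution_class T" "duhamel_solution T lam F h u"
    and v: "v \<in> solution_class T" "duhamel_solution T lam F h v"
    and t: "t \<in> {0..<T}"
  shows "u t = v t"
proof -
  define T' where "T' = (t + T) / 2"
  have T': "T' \<in> {0<..<T}" "t \<in> {0..T'}" using t by (auto simp: T'_def)
  obtain U where U: "\<And>t x. apply_bcontfun U (t, x) = apply_bcontfun (u (clip T' t)) x"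
    using solution_class_clip[OF u(1) T'(1)] by blast
  obtain V where V: "\<And>t x. apply_bcontfun V (t, x) = apply_bcontfun (v (clip T' t)) x"
    using solution_class_clip[OF v(1) T'(1)] by blast
  define R where "R = max (norm U) (norm V)"
  have c: "continuous_on UNIV F" using F by (rule holomorphic_on_imp_continuous_on)
  obtain L where L: "L > 0" "\<And>z w. z \<in> cball 0 R \<Longrightarrow> w \<in> cball 0 R \<Longrightarrow> norm (F z - F w) \<le> L * norm (z - w)"
    using entire_lipschitz_on_cball[OF F] by blast
  have eq: "apply_bcontfun W (r, x) = heat r (apply_bcontfun h) x
        + complex_of_real lam * duhamel_int (\<lambda>p. F (apply_bcontfun W p)) r x"
    if w: "duhamel_solution T lam F h w" and W: "\<And>t x. apply_bcontfun W (t, x) = apply_bcontfun (w (clip T' t)) x"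
      and r: "r \<in> {0..T'}" for w W r x
  proof -
    have "duhamel_int (\<lambda>p. F (apply_bcontfun W p)) r x
        = (LINT s:{0..r}|lborel. heat (r - s) (\<lambda>y. F (apply_bcontfun (w s) y)) x)"
      unfolding duhamel_int_def W
      by (rule set_lebesgue_integral_cong) (use r in \<open>auto simp: clip_ident\<close>)
    then show ?thesis
      using w r T'(1) by (simp add: duhamel_solution_def W clip_ident)
  qed
  have "apply_bcontfun U (t, x) = apply_bcontfun V (t, x)" for x
    using duhamel_equation_unique[OF c L(2) L(1) _ _ lam eq[OF u(2) U] eq[OF v(2) V] T'(2)]
    by (simp add: R_def)
  then show ?thesis using T'(2) by (intro bcontfun_eqI) (simp add: U V clip_ident)
qed

section \<open>Regularity of mild solutions\<close>

text \<open>The Duhamel part is norm continuous at all times. The free part is so at positive times, and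
at time \<open>0\<close> if the datum is uniformly continuous.\<close>

lemma time_slice_tendsto:
  fixes h :: "'n::finite Y"
  assumes F: "continuous_on UNIV F" "\<And>z. norm (F z) \<le> M"
    and U: "mild_solution T lam F h U"
    and \<tau>: "\<And>n. \<tau> n \<in> {0..<T}" "t \<in> {0..<T}" "\<tau> \<longlonglongrightarrow> t"
    and or: "t > 0 \<or> uniformly_continuous_on UNIV (apply_bcontfun h)"
  shows "(\<lambda>n. time_slice U (\<tau> n)) \<longlonglongrightarrow> time_slice U t"
proof (rule bcontfun_tendsto_if_along_points)
  fix X :: "nat \<Rightarrow> real ^ 'n"
  let ?D = "duhamel_int (\<lambda>p. F (apply_bcontfun U p))"
  let ?h = "apply_bcontfun h"
  have h: "continuous_on UNIV ?h" "\<And>y. norm (?h y) \<le> norm h" by (auto intro: norm_bounded)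
  have slice: "apply_bcontfun (time_slice U r) y = heat r ?h y + complex_of_real lam * ?D r y"
    if "r \<in> {0..<T}" for r y
    using U that by (simp add: mild_solution_def clip_ident)
  have "(\<lambda>n. heat (\<tau> n) ?h (X n) - heat t ?h (X n)) \<longlonglongrightarrow> 0"
  proof (cases "t > 0")
    case True
    then show ?thesis by (rule heat_tendsto_time[OF h _ \<tau>(3)])
  next
    case False
    with \<tau>(2) have t: "t = 0" by simp
    have "heat 0 ?h x = ?h x" for x by (simp add: heat_def)
    then show ?thesis
      using heat_tendsto_uniform[where \<tau> = \<tau> and X = X, OF _ h(2)] or \<tau> t by simp
  qed
  moreover have "(\<lambda>n. complex_of_real lam * (?D (\<tau> n) (X n) - ?D t (X n))) \<longlonglongrightarrow> 0"
    using \<tau> by (intro tendsto_mult_right_zero duhamel_int_tendsto_time[OF continuous_on_comp_bcontfun[OF F(1)] F(2)]) auto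
  ultimately have "(\<lambda>n. (heat (\<tau> n) ?h (X n) - heat t ?h (X n))
      + complex_of_real lam * (?D (\<tau> n) (X n) - ?D t (X n))) \<longlonglongrightarrow> 0 + 0"
    by (rule tendsto_add)
  then show "(\<lambda>n. apply_bcontfun (time_slice U (\<tau> n)) (X n) - apply_bcontfun (time_slice U t) (X n)) \<longlonglongrightarrow> 0"
    unfolding slice[OF \<tau>(1)] slice[OF \<tau>(2)] by (simp add: algebra_simps)
qed

lemma time_slice_in_solution_class:
  fixes h :: "'n::finite Y"
  assumes F: "continuous_on UNIV F" "\<And>z. norm (F z) \<le> M"
    and U: "mild_solution T lam F h U"
  shows "time_slice U \<in> solution_class T"
  unfolding solution_class_def mem_Collect_eq
proof (intro conjI allI impI ballI)
  show "Y_continuous_on {0<..<T} (time_slice U)"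
    unfolding Y_continuous_on_iff continuous_on_sequentially o_def
  proof safe
    fix \<tau> t assume \<tau>: "\<forall>n. \<tau> n \<in> {0<..<T}" "t \<in> {0<..<T}" "\<tau> \<longlonglongrightarrow> t"
    show "(\<lambda>n. time_slice U (\<tau> n)) \<longlonglongrightarrow> time_slice U t"
    proof (rule time_slice_tendsto[OF F U _ _ \<tau>(3)])
      show "\<tau> n \<in> {0..<T}" for n using \<tau>(1)[rule_format, of n] by simp
    qed (use \<tau>(2) in auto)
  qed
  show "\<exists>B. \<forall>t\<in>{0..T'}. Y_norm (time_slice U t) \<le> B" for T'
  proof (intro exI ballI)
    fix t
    have "norm (time_slice U t) \<le> norm U" by (rule norm_bound) (simp add: norm_bounded)
    then show "Y_norm (time_slice U t) \<le> norm U" using Y_norm_le_norm by (rule order_trans[rotated])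
  qed
  fix K :: "(real ^ 'n) set" assume K: "compact K"
  show "uniform_limit K (\<lambda>t. apply_bcontfun (time_slice U t)) (apply_bcontfun (time_slice U 0)) (at 0 within {0..<T})"
  proof (rule uniform_limitI)
    fix e :: real assume e: "e > 0"
    have "uniformly_continuous_on ({0..T} \<times> K) (apply_bcontfun U)"
      using K by (intro compact_uniformly_continuous compact_Times) auto
    then obtain d where d: "d > 0" "\<And>p q. p \<in> {0..T} \<times> K \<Longrightarrow> q \<in> {0..T} \<times> K \<Longrightarrow> dist q p < d \<Longrightarrow>
        dist (apply_bcontfun U q) (apply_bcontfun U p) < e"
      using e unfolding uniformly_continuous_on_def by metis
    show "\<forall>\<^sub>F t in at 0 within {0..<T}. \<forall>x\<in>K. dist (apply_bcontfun (time_slice U t) x) (apply_bcontfun (time_slice U 0) x) < e"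
      unfolding eventually_at
    proof (intro exI[of _ d] conjI ballI impI d(1))
      fix t x assume "t \<in> {0..<T}" "t \<noteq> 0 \<and> dist t 0 < d" "x \<in> K"
      then show "dist (apply_bcontfun (time_slice U t) x) (apply_bcontfun (time_slice U 0) x) < e"
        using d(2)[of "(0, x)" "(t, x)"] by (simp add: dist_Pair_Pair)
    qed
  qed
qed

text \<open>Norm continuity at \<open>0\<close> makes \<open>h\<close> a uniform limit of the uniformly continuous functions \<open>heat t h\<close>.
The proof takes one time \<open>t\<close> at which \<open>heat t h\<close> is within \<open>e / 3\<close> of \<open>h\<close>.\<close>

lemma time_slice_continuous_iff:
  fixes h :: "'n::finite Y"
  assumes F: "continuous_on UNIV F" "\<And>z. norm (F z) \<le> M" and lam: "\<bar>lam\<bar> \<le> 1"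
    and U: "mild_solution T lam F h U" and T: "T > 0"
  shows "continuous_on {0..<T} (time_slice U) \<longleftrightarrow> uniformly_continuous_on UNIV (apply_bcontfun h)"
proof
  assume h: "uniformly_continuous_on UNIV (apply_bcontfun h)"
  show "continuous_on {0..<T} (time_slice U)"
    unfolding continuous_on_sequentially o_def
    by (intro allI ballI impI time_slice_tendsto[OF F U]) (use h in auto)
next
  assume cont: "continuous_on {0..<T} (time_slice U)"
  let ?h = "apply_bcontfun h"
  let ?D = "duhamel_int (\<lambda>p. F (apply_bcontfun U p))"
  have h: "continuous_on UNIV ?h" "\<And>y. norm (?h y) \<le> norm h" by (auto intro: norm_bounded)
  note FU = continuous_on_comp_bcontfun[OF F(1)]
  have eq: "apply_bcontfun (time_slice U t) x = heat t ?h x + complex_of_real lam * ?D t x" if "t \<in> {0..<T}" for t x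
    using U that by (simp add: mild_solution_def clip_ident)
  have D: "norm (complex_of_real lam * ?D t x) \<le> t * M" if "t \<ge> 0" for t x
    using mult_mono[OF lam norm_duhamel_int_le[OF FU F(2) that]] by (simp add: norm_mult)
  have zero: "apply_bcontfun (time_slice U 0) x = ?h x" for x
    using eq[of 0 x] D[of 0 x] T by (simp add: heat_def)
  define \<tau> where "\<tau> n = T / real (Suc (Suc n))" for n
  have \<tau>: "\<tau> n \<in> {0<..<T}" for n using T by (auto simp: \<tau>_def divide_less_eq)
  have "(\<lambda>n. T * (1 / real (Suc (Suc n)))) \<longlonglongrightarrow> T * 0"
    by (intro tendsto_intros LIMSEQ_Suc lim_1_over_n)
  then have lim: "\<tau> \<longlonglongrightarrow> 0" by (simp add: \<tau>_def[abs_def])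
  have in0: "\<forall>\<^sub>F n in sequentially. \<tau> n \<in> {0..<T}"
    using \<tau> by (intro always_eventually allI) (auto simp: less_imp_le)
  have "(\<lambda>n. time_slice U (\<tau> n)) \<longlonglongrightarrow> time_slice U 0"
    by (rule continuous_on_tendsto_compose[OF cont lim _ in0]) (use T in auto)
  then have "(\<lambda>n. dist (time_slice U (\<tau> n)) (time_slice U 0) + \<tau> n * M) \<longlonglongrightarrow> 0 + 0 * M"
    by (intro tendsto_add tendsto_mult lim tendsto_const tendsto_dist_iff[THEN iffD1])
  then have small: "(\<lambda>n. dist (time_slice U (\<tau> n)) (time_slice U 0) + \<tau> n * M) \<longlonglongrightarrow> 0" by simp
  show "uniformly_continuous_on UNIV ?h"
    unfolding uniformly_continuous_on_def
  proof (intro allI impI)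
    fix e :: real assume e: "e > 0"
    then obtain n where n: "dist (time_slice U (\<tau> n)) (time_slice U 0) + \<tau> n * M < e / 3"
      using eventually_happens[OF order_tendstoD(2)[OF small, of "e / 3"]] by auto
    let ?t = "\<tau> n"
    have close: "dist (heat ?t ?h x) (?h x) < e / 3" for x
    proof -
      have "heat ?t ?h x - ?h x = (apply_bcontfun (time_slice U ?t) x - apply_bcontfun (time_slice U 0) x)
          - complex_of_real lam * ?D ?t x"
        using eq[of ?t x] zero[of x] \<tau>[of n] by simp
      also have "norm \<dots> \<le> dist (time_slice U ?t) (time_slice U 0) + ?t * M"
        using \<tau>[of n] by (intro order_trans[OF norm_triangle_ineq4] add_mono norm_bcontfun_diff_le D) auto
      finally show ?thesis using n by (simp add: dist_norm)
    qed
    have "uniformly_continuous_on UNIV (heat ?t ?h)"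
      using \<tau>[of n] by (intro uniformly_continuous_heat[OF h]) auto
    moreover have "e / 3 > 0" using e by simp
    ultimately obtain d where d: "d > 0"
      "\<And>x y. dist y x < d \<Longrightarrow> dist (heat ?t ?h y) (heat ?t ?h x) < e / 3"
      unfolding uniformly_continuous_on_def by (metis UNIV_I)
    have "dist (?h y) (?h x) < e" if "dist y x < d" for x y
      using close[of x] close[of y] d(2)[OF that]
        dist_triangle[of "?h y" "?h x" "heat ?t ?h y"] dist_triangle[of "heat ?t ?h y" "?h x" "heat ?t ?h x"]
      by (simp add: dist_commute)
    then show "\<exists>d>0. \<forall>x\<in>UNIV. \<forall>y\<in>UNIV. dist y x < d \<longrightarrow> dist (?h y) (?h x) < e"
      using d(1) by blast
  qed
qed

section \<open>Local well-posedness\<close>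

text \<open>The nearest-point projection onto a disc is \<open>1\<close>-Lipschitz, so composing with it carries the bound
and the Lipschitz constant of \<open>F\<close> on the disc over to the whole plane.\<close>

lemma truncation:
  assumes F: "F holomorphic_on UNIV" and R: "R \<ge> 0"
  obtains G L M where "continuous_on UNIV G" "\<And>z. norm (G z) \<le> M" "L \<ge> 0" "M \<ge> 0"
    "\<And>z w. norm (G z - G w) \<le> L * norm (z - w)" "\<And>z. z \<in> cball 0 R \<Longrightarrow> G z = F z"
proof -
  let ?c = "closest_point (cball (0::complex) R)"
  have c: "?c z \<in> cball 0 R" for z using R by (intro closest_point_in_set) auto
  obtain L where L: "L > 0" "\<And>z w. z \<in> cball 0 R \<Longrightarrow> w \<in> cball 0 R \<Longrightarrow> norm (F z - F w) \<le> L * norm (z - w)"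
    using entire_lipschitz_on_cball[OF F] by blast
  have cF: "continuous_on A F" for A
    using holomorphic_on_imp_continuous_on[OF F] continuous_on_subset by blast
  have "compact (F ` cball 0 R)" by (intro compact_continuous_image cF) auto
  from compact_imp_bounded[OF this]
  obtain M where M: "\<And>z. z \<in> cball 0 R \<Longrightarrow> norm (F z) \<le> M" unfolding bounded_iff by fast
  show thesis
  proof (rule that[of "\<lambda>z. F (?c z)" M L])
    show "continuous_on UNIV (\<lambda>z. F (?c z))"
      using R by (intro continuous_on_compose2[OF cF[of UNIV]] continuous_on_closest_point) auto
    show "norm (F (?c z)) \<le> M" for z by (rule M[OF c])
    then show "M \<ge> 0" using norm_ge_zero order_trans by blast
    show "norm (F (?c z) - F (?c w)) \<le> L * norm (z - w)" for z w
    proof -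
      have "norm (F (?c z) - F (?c w)) \<le> L * norm (?c z - ?c w)" by (intro L c)
      also have "norm (?c z - ?c w) \<le> norm (z - w)"
        using closest_point_lipschitz[of "cball (0::complex) R" z w] R by (simp add: dist_norm)
      finally show ?thesis using L(1) by simp
    qed
    show "F (?c z) = F z" if "z \<in> cball 0 R" for z using that by (simp add: closest_point_self)
  qed (use L in auto)
qed

theorem local_well_posedness:
  fixes g :: "'n::finite Y"
  assumes F: "F holomorphic_on UNIV" and lam: "\<bar>lam\<bar> \<le> 1"
  shows "\<exists>T>0. \<exists>\<delta>>0. \<exists>S :: 'n Y \<Rightarrow> real \<Rightarrow> 'n Y.
    (\<forall>h\<in>Y_ball g \<delta>.
        S h \<in> solution_class T \<and>
        duhamel_solution T lam F h (S h) \<and>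
        (\<forall>v\<in>solution_class T. duhamel_solution T lam F h v \<longrightarrow>
            (\<forall>t\<in>{0..<T}. v t = S h t)) \<and>
        (Y_continuous_on {0..<T} (S h) \<longleftrightarrow> uniformly_continuous_on UNIV (apply_bcontfun h))) \<and>
    (\<forall>h\<in>Y_ball g \<delta>. \<forall>\<epsilon>>0. \<exists>\<eta>>0. \<forall>k\<in>Y_ball g \<delta>. Y_norm (k - h) < \<eta> \<longrightarrow>
        (\<forall>t\<in>{0..<T}. Y_norm (S k t - S h t) < \<epsilon>))"
proof -
  \<comment> \<open>data within \<open>1\<close> of \<open>g\<close> have supremum norm at most \<open>norm g + 2\<close>, and the Duhamel integral adds at most \<open>T * M \<le> 1\<close>\<close>
  define R where "R = norm g + 3"
  have "R \<ge> 0" by (simp add: R_def)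
  obtain G L M where G: "continuous_on UNIV G" "\<And>z. norm (G z) \<le> M" and LM: "L \<ge> 0" "M \<ge> 0"
    and L: "\<And>z w. norm (G z - G w) \<le> L * norm (z - w)" and GF: "\<And>z. z \<in> cball 0 R \<Longrightarrow> G z = F z"
    by (rule truncation[OF F \<open>R \<ge> 0\<close>], rule that)
  \<comment> \<open>short enough for a contraction factor \<open>1/2\<close> and for the solution to stay inside the disc\<close>
  define T where "T = 1 / (2 * (L + M + 1))"
  have T: "T > 0" "T * L \<le> 1 / 2" "T * M \<le> 1" using LM by (auto simp: T_def field_simps)
  have "\<exists>U. mild_solution T lam G h U" for h :: "'n Y"
    using mild_solution_exists[OF G L LM(1) lam, of T h] T by force
  then obtain sol where sol: "\<And>h :: 'n Y. mild_solution T lam G h (sol h)" by metis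
  define S where "S h = time_slice (sol h)" for h
  have duh: "duhamel_solution T lam F h (S h)" if "h \<in> Y_ball g 1" for h
  proof -
    have "norm (h - g) \<le> 2 * Y_norm (h - g)" by (rule norm_le_Y_norm)
    also have "\<dots> \<le> 2" using that by (simp add: Y_ball_def)
    finally have "norm h \<le> norm g + 2" using norm_triangle_sub[of h g] by linarith
    then have "norm (sol h) \<le> R"
      using norm_mild_solution_le[OF G lam _ sol[of h]] T by (simp add: R_def)
    then have "G (apply_bcontfun (sol h) p) = F (apply_bcontfun (sol h) p)" for p
      using norm_bounded[of "sol h" p] by (intro GF) auto
    then show ?thesis
      using sol[of h] unfolding mild_solution_def
      by (subst duhamel_solution_iff_slices[where U = "sol h"]) (auto simp: S_def clip_ident)
  qed
  have cls: "S h \<in> solution_class T" for h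
    unfolding S_def by (rule time_slice_in_solution_class[OF G sol])
  have uniq: "v t = S h t" if "h \<in> Y_ball g 1" "v \<in> solution_class T" "duhamel_solution T lam F h v"
    "t \<in> {0..<T}" for h v t
    by (rule duhamel_solution_unique[OF F lam that(2,3) cls duh that(4)]) fact
  have cont: "Y_continuous_on {0..<T} (S h) \<longleftrightarrow> uniformly_continuous_on UNIV (apply_bcontfun h)" for h
    unfolding S_def Y_continuous_on_iff by (rule time_slice_continuous_iff[OF G lam sol T(1)])
  have dep: "Y_norm (S k t - S h t) < \<epsilon>" if "Y_norm (k - h) < \<epsilon> / 4" for h k t \<epsilon>
  proof -
    have "Y_norm (S k t - S h t) \<le> norm (S k t - S h t)" by (rule Y_norm_le_norm)
    also have "\<dots> \<le> dist (sol k) (sol h)" unfolding S_def by (rule norm_time_slice_diff_le)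
    also have "\<dots> \<le> 2 * norm (k - h)"
      using mild_solution_dependence[OF G L LM(1) lam _ _ sol sol, of k h] T by simp
    also have "\<dots> \<le> 2 * (2 * Y_norm (k - h))" using norm_le_Y_norm by (intro mult_left_mono) auto
    also have "\<dots> < \<epsilon>" using that by simp
    finally show ?thesis .
  qed
  show ?thesis
  proof (rule exI[of _ T], rule conjI[OF T(1)], rule exI[of _ 1], rule conjI[OF zero_less_one],
      rule exI[of _ S], intro conjI ballI allI impI)
    fix h \<epsilon> assume "(\<epsilon>::real) > 0"
    then show "\<exists>\<eta>>0. \<forall>k\<in>Y_ball g 1. Y_norm (k - h) < \<eta> \<longrightarrow> (\<forall>t\<in>{0..<T}. Y_norm (S k t - S h t) < \<epsilon>)"
      using dep by (intro exI[of _ "\<epsilon> / 4"]) auto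
  qed (use cls duh uniq cont in auto)
qed

theorem corollary1p2:
  fixes m :: nat and chi :: "nat \<Rightarrow> complex" and lam :: real
    and g :: "(real ^ 'n::finite) \<Rightarrow>\<^sub>C complex"
  assumes "dirichlet_character m chi"
    and "\<not> principal_character m chi"
    and "lam \<in> {-1, 1}"
  shows "\<exists>T>0. \<exists>\<delta>>0. \<exists>S :: 'n Y \<Rightarrow> real \<Rightarrow> 'n Y.
    (\<forall>h\<in>Y_ball g \<delta>.
        S h \<in> solution_class T \<and>
        duhamel_solution T lam (dirichlet_L chi) h (S h) \<and>
        (\<forall>v\<in>solution_class T. duhamel_solution T lam (dirichlet_L chi) h v \<longrightarrow>
            (\<forall>t\<in>{0..<T}. v t = S h t)) \<and>
        (Y_continuous_on {0..<T} (S h) \<longleftrightarrow> uniformly_continuous_on UNIV (apply_bcontfun h))) \<and>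
    (\<forall>h\<in>Y_ball g \<delta>. \<forall>\<epsilon>>0. \<exists>\<eta>>0. \<forall>k\<in>Y_ball g \<delta>. Y_norm (k - h) < \<eta> \<longrightarrow>
        (\<forall>t\<in>{0..<T}. Y_norm (S k t - S h t) < \<epsilon>))"
  using assms by (intro local_well_posedness dirichlet_L_entire) auto

end
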